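(* For every integer $n \geq 7$ there is a simple graph with $n$ vertices and $4n-8$ edges which is 1-visible and not 1-planar.
   Context: Graphs are finite, simple and undirected. A drawing of a graph in the plane maps vertices to distinct points and edges to Jordan arcs between their endpoints; it is 1-planar if each edge is crossed at most once, where crossings between edges sharing an endpoint are excluded. A graph is 1-planar if it has a 1-planar drawing. A 1-visibility representation of a graph $G=(V,E)$ assigns to each vertex $v$ a closed horizontal segment $\Gamma(v)$ (vertex-segment, possibly degenerate) and to each edge $e=(u,v)$ a vertical segment $\Gamma(e)$ (edge-segment) from some point on $\Gamma(u)$ to some point on $\Gamma(v)$. The endpoints of all segments are grid points (integer coordinates). Distinct vertex-segments do not overlap (they are disjoint), and distinct edge-segments do not overlap in their interiors. An edge-segment $\Gamma(e)$ crosses a vertex-segment $\Gamma(w)$ if they intersect and $w$ is not an end vertex of $e$. Each vertex-segment is crossed by at most one edge-segment, and each edge-segment crosses at most one vertex-segment. Visibility is in the weak sense: vertex-segments that see each other need not be adjacent. A graph is 1-visible if it has a 1-visibility representation. *)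

theory Defs
  imports "HOL-Analysis.Analysis"
begin

definition simple_graph :: "'v set \<Rightarrow> 'v set set \<Rightarrow> bool" where
  "simple_graph V E \<longleftrightarrow> finite V \<and> E \<subseteq> {e. e \<subseteq> V \<and> card e = 2}"

text \<open>
  The plane is the type \<^typ>\<open>complex\<close>. In a drawing, \<open>p v\<close> is the point of the vertex \<open>v\<close> and
  \<open>g e\<close> is a parametrisation of the Jordan arc of the edge \<open>e\<close>; its orientation is immaterial.
  As usual, an edge passes through no vertex other than its two endpoints.
\<close>

definition drawing :: "'v set \<Rightarrow> 'v set set \<Rightarrow> ('v \<Rightarrow> complex) \<Rightarrow> ('v set \<Rightarrow> real \<Rightarrow> complex) \<Rightarrow> bool"
  where
  "drawing V E p g \<longleftrightarrow>
     inj_on p V \<and>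
     (\<forall>e\<in>E. arc (g e) \<and> {pathstart (g e), pathfinish (g e)} = p ` e \<and>
            path_image (g e) \<inter> p ` V = p ` e)"

definition arc_interior :: "(real \<Rightarrow> complex) \<Rightarrow> complex set" where
  "arc_interior c = path_image c - {pathstart c, pathfinish c}"

text \<open>
  Every common interior point of two edges is a crossing, so touching points count as well.
  Crossings of \<open>e\<close> are recorded together with the other edge: a point at which \<open>e\<close> meets
  two further edges counts twice.
\<close>

definition crossings :: "'v set set \<Rightarrow> ('v set \<Rightarrow> real \<Rightarrow> complex) \<Rightarrow> 'v set \<Rightarrow> ('v set \<times> complex) set"
  where
  "crossings E g e =
     {(f, z). f \<in> E \<and> f \<noteq> e \<and> z \<in> arc_interior (g e) \<inter> arc_interior (g f)}"

definition one_planar_drawing ::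
    "'v set \<Rightarrow> 'v set set \<Rightarrow> ('v \<Rightarrow> complex) \<Rightarrow> ('v set \<Rightarrow> real \<Rightarrow> complex) \<Rightarrow> bool"
  where
  "one_planar_drawing V E p g \<longleftrightarrow>
     drawing V E p g \<and>
     (\<forall>e\<in>E. finite (crossings E g e) \<and> card (crossings E g e) \<le> 1) \<and>
     (\<forall>e\<in>E. \<forall>f\<in>E. e \<noteq> f \<and> e \<inter> f \<noteq> {} \<longrightarrow> arc_interior (g e) \<inter> arc_interior (g f) = {})"

definition one_planar :: "'v set \<Rightarrow> 'v set set \<Rightarrow> bool" where
  "one_planar V E \<longleftrightarrow> (\<exists>p g. one_planar_drawing V E p g)"

definition grid_point :: "complex \<Rightarrow> bool" where
  "grid_point z \<longleftrightarrow> Re z \<in> \<int> \<and> Im z \<in> \<int>"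

text \<open>
  The segment of the vertex \<open>v\<close> has the endpoints \<open>a v\<close> and \<open>b v\<close>, and the segment of the edge \<open>e\<close>
  has the endpoints \<open>c e\<close> and \<open>d e\<close>.
\<close>

definition crosses_vertex ::
    "('v \<Rightarrow> complex) \<Rightarrow> ('v \<Rightarrow> complex) \<Rightarrow> ('v set \<Rightarrow> complex) \<Rightarrow> ('v set \<Rightarrow> complex) \<Rightarrow>
     'v set \<Rightarrow> 'v \<Rightarrow> bool"
  where
  "crosses_vertex a b c d e w \<longleftrightarrow>
     w \<notin> e \<and> closed_segment (c e) (d e) \<inter> closed_segment (a w) (b w) \<noteq> {}"

definition one_visibility_representation ::
    "'v set \<Rightarrow> 'v set set \<Rightarrow> ('v \<Rightarrow> complex) \<Rightarrow> ('v \<Rightarrow> complex) \<Rightarrow>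
     ('v set \<Rightarrow> complex) \<Rightarrow> ('v set \<Rightarrow> complex) \<Rightarrow> bool"
  where
  "one_visibility_representation V E a b c d \<longleftrightarrow>
     (\<forall>v\<in>V. grid_point (a v) \<and> grid_point (b v) \<and> Im (a v) = Im (b v)) \<and>
     (\<forall>e\<in>E. grid_point (c e) \<and> grid_point (d e) \<and> Re (c e) = Re (d e) \<and>
        (\<exists>u v. e = {u, v} \<and> c e \<in> closed_segment (a u) (b u) \<and> d e \<in> closed_segment (a v) (b v))) \<and>
     (\<forall>v\<in>V. \<forall>w\<in>V. v \<noteq> w \<longrightarrow> closed_segment (a v) (b v) \<inter> closed_segment (a w) (b w) = {}) \<and>
     (\<forall>e\<in>E. \<forall>f\<in>E. e \<noteq> f \<longrightarrow> open_segment (c e) (d e) \<inter> open_segment (c f) (d f) = {}) \<and>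
     (\<forall>w\<in>V. card {e\<in>E. crosses_vertex a b c d e w} \<le> 1) \<and>
     (\<forall>e\<in>E. card {w\<in>V. crosses_vertex a b c d e w} \<le> 1)"

definition one_visible :: "'v set \<Rightarrow> 'v set set \<Rightarrow> bool" where
  "one_visible V E \<longleftrightarrow> (\<exists>a b c d. one_visibility_representation V E a b c d)"

end

theory Submission
  imports Defs
begin

text \<open>
  The graph is \<open>K\<^sub>7\<close> minus one edge, extended by vertices of degree four that are added one at a time.
  The added vertices get ever wider bars on top of each other, so that each of them sees a fixed bar on the left,
  a fixed bar on the right, its predecessor, and, through its predecessor, the one before.

  That \<open>K\<^sub>7\<close> minus an edge is not 1-planar uses no topology besides the nonplanarity of \<open>K\<^sub>3\<^sub>,\<^sub>3\<close>,
  which follows from the Jordan curve theorem: two of the three long diagonals of a hexagon lie on the same side.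
  Two crossings with three common vertices and a further vertex adjacent to those three would give
  a plane \<open>K\<^sub>3\<^sub>,\<^sub>3\<close>, whose second class consists of the two crossing points and the further vertex.
  So the pairs of vertices of a \<open>K\<^sub>6\<close> that are left over by its crossings are disjoint, and since every
  \<open>K\<^sub>3\<^sub>,\<^sub>3\<close> contains a crossing they form three pairs \<open>vq\<close>, \<open>ab\<close>, \<open>cd\<close>, and up to names
  \<open>va\<close> crosses \<open>qb\<close>, \<open>vc\<close> crosses \<open>qd\<close> and \<open>ad\<close> crosses \<open>bc\<close>.
  The two copies of \<open>K\<^sub>6\<close> in \<open>K\<^sub>7\<close> minus an edge share the last crossing, and their
  other crossings then need some edge at \<open>q\<close> to be crossed twice, or have three common vertices.
\<close>

subsection \<open>The nonplanarity of \<open>K\<^sub>3\<^sub>,\<^sub>3\<close>\<close>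

lemma arc_interior_nonempty: "arc c \<Longrightarrow> arc_interior c \<noteq> {}"
  unfolding arc_interior_def using arc_imp_simple_path nonempty_simple_path_endless by blast

lemma connected_arc_interior: "arc c \<Longrightarrow> connected (arc_interior c)"
  unfolding arc_interior_def by (simp add: arc_imp_simple_path connected_simple_path_endless)

text \<open>Connectedness arguments use an arc without its ends, since these lie on the curve to be
  avoided. The ends come back as limit points.\<close>

lemma path_image_subset_closure_arc_interior:
  assumes "arc c"
  shows "path_image c \<subseteq> closure (arc_interior c)"
proof -
  have "c ` closure {0<..<1} \<subseteq> closure (arc_interior c)"
  proof (rule image_closure_subset)
    show "continuous_on (closure {0<..<1}) c"
      using assms by (simp add: arc_def path_def)
    have "c x \<noteq> c 0" "c x \<noteq> c 1" if "x \<in> {0<..<1}" for x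
      using assms that unfolding arc_def by (auto dest!: inj_onD[where x = x])
    then show "c ` {0<..<1} \<subseteq> closure (arc_interior c)"
      using closure_subset unfolding arc_interior_def path_image_def pathstart_def pathfinish_def by fastforce
  qed simp
  then show ?thesis by (simp add: path_image_def)
qed

lemma closure_inside_subset:
  fixes S :: "complex set"
  shows "closed S \<Longrightarrow> closure (inside S) \<subseteq> inside S \<union> S"
  by (metis Un_Diff_cancel2 Un_mono closed_Un_complement_component closure_Un_frontier frontier_inside_subset
      order_refl)

text \<open>The chord \<open>c\<close> splits the inside of the closed curve into two regions, one
  bounded by \<open>c1\<close> and \<open>c\<close>, the other by \<open>c2\<close> and
  \<open>c\<close>. The connected set \<open>D\<close> avoids \<open>c\<close> and so stays in one
  of them, whose closure misses \<open>q\<close> or \<open>p\<close>.\<close>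

lemma interlacing_chords_inside:
  assumes c1: "arc c1" "pathstart c1 = s" "pathfinish c1 = t"
    and c2: "arc c2" "pathstart c2 = s" "pathfinish c2 = t"
    and c: "arc c" "pathstart c = s" "pathfinish c = t"
    and c12: "path_image c1 \<inter> path_image c2 = {s, t}"
    and c1c: "path_image c1 \<inter> path_image c = {s, t}"
    and c2c: "path_image c2 \<inter> path_image c = {s, t}"
    and D: "connected D" "D \<inter> path_image c = {}"
    and p: "p \<in> path_image c1 - {s, t}" "p \<in> closure D"
    and q: "q \<in> path_image c2 - {s, t}" "q \<in> closure D"
    and chord_in: "arc_interior c \<subseteq> inside (path_image c1 \<union> path_image c2)"
    and D_in: "D \<subseteq> inside (path_image c1 \<union> path_image c2)"
  shows False
proof -
  let ?I = "inside (path_image c1 \<union> path_image c2)"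
  let ?I1 = "inside (path_image c1 \<union> path_image c)"
  let ?I2 = "inside (path_image c2 \<union> path_image c)"
  have st: "s \<noteq> t" using c1 arc_distinct_ends by blast
  have ne: "path_image c \<inter> ?I \<noteq> {}"
    using arc_interior_nonempty[OF c(1)] chord_in unfolding arc_interior_def by blast
  have sp: "simple_path c1" "simple_path c2" "simple_path c"
    using c1 c2 c by (auto intro: arc_imp_simple_path)
  obtain I12: "?I1 \<inter> ?I2 = {}"
    and Iun: "?I1 \<union> ?I2 \<union> (path_image c - {s, t}) = ?I"
    using split_inside_simple_closed_curve[OF sp(1) c1(2,3) sp(2) c2(2,3) sp(3) c(2,3) st c12 c1c c2c ne]
    by blast
  have closed: "closed (path_image c1)" "closed (path_image c2)" "closed (path_image c)"
    using c1 c2 c by (auto intro: closed_path_image arc_imp_path)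
  have op: "open ?I1" "open ?I2"
    using closed by (auto intro!: open_inside closed_Un)
  have noJ: "?I \<inter> (path_image c1 \<union> path_image c2) = {}"
    by (rule inside_no_overlap)
  have "D \<subseteq> ?I1 \<union> ?I2" using D_in D(2) Iun by blast
  moreover have "?I1 \<inter> ?I2 \<inter> D = {}" using I12 by blast
  ultimately have "?I1 \<inter> D = {} \<or> ?I2 \<inter> D = {}"
    using connectedD[OF D(1) op] by blast
  with \<open>D \<subseteq> ?I1 \<union> ?I2\<close> consider "D \<subseteq> ?I1" | "D \<subseteq> ?I2" by blast
  then show False
  proof cases
    case 1
    then have "q \<in> ?I1 \<union> (path_image c1 \<union> path_image c)"
      using q(2) closure_mono[OF 1] closure_inside_subset[of "path_image c1 \<union> path_image c"] closed by blast
    moreover have "q \<notin> ?I1" using Iun noJ q(1) by blast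
    ultimately show False using q(1) c12 c2c by blast
  next
    case 2
    then have "p \<in> ?I2 \<union> (path_image c2 \<union> path_image c)"
      using p(2) closure_mono[OF 2] closure_inside_subset[of "path_image c2 \<union> path_image c"] closed by blast
    moreover have "p \<notin> ?I2" using Iun noJ p(1) by blast
    ultimately show False using p(1) c12 c1c by blast
  qed
qed

text \<open>The punctured inside has an unbounded image, so it lands outside the image curve. If the
  outside landed there too, nothing but \<open>0 = f z0\<close> would be left for the inside of the
  image curve, which is open and nonempty.\<close>

lemma inversion_maps_outside_to_inside:
  fixes g :: "real \<Rightarrow> complex"
  assumes g: "simple_path g" "pathfinish g = pathstart g"
    and z0: "z0 \<in> inside (path_image g)"
  defines "f \<equiv> \<lambda>z. inverse (z - z0)"
  shows "f ` outside (path_image g) \<subseteq> inside (f ` path_image g)"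
proof -
  let ?J = "path_image g"
  have J: "open (inside ?J)" "connected (inside ?J)" "open (outside ?J)" "connected (outside ?J)"
       "inside ?J \<inter> outside ?J = {}" "inside ?J \<union> outside ?J = - ?J"
    using Jordan_inside_outside[OF g] by blast+
  have z0J: "z0 \<notin> ?J" "z0 \<notin> outside ?J" using z0 J(5,6) by blast+
  have contf: "continuous_on S f" if "z0 \<notin> S" for S
    unfolding f_def by (intro continuous_intros) (use that in auto)
  \<comment> \<open>The convention \<open>inverse 0 = 0\<close> sends \<open>z0\<close> to 0, a
    value taken nowhere else. So \<open>f\<close> is injective on the whole plane, though continuous
    only off \<open>z0\<close>.\<close>
  have injf: "inj_on f S" for S
    unfolding f_def inj_on_def by simp
  have sg: "simple_path (f \<circ> g)" "pathfinish (f \<circ> g) = pathstart (f \<circ> g)"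
    using simple_path_continuous_image[OF g(1) contf[OF z0J(1)] injf] g(2)
    by (auto simp: pathstart_def pathfinish_def)
  have im: "path_image (f \<circ> g) = f ` ?J" by (rule path_image_compose)
  let ?K = "f ` ?J"
  have K: "open (inside ?K)" "inside ?K \<noteq> {}" "open (outside ?K)" "bounded (inside ?K)"
       "inside ?K \<inter> outside ?K = {}" "inside ?K \<union> outside ?K = - ?K"
    using Jordan_inside_outside[OF sg] unfolding im by blast+
  have side: "f ` S \<subseteq> inside ?K \<or> f ` S \<subseteq> outside ?K"
    if "connected S" "S \<inter> ?J = {}" "z0 \<notin> S" for S
  proof -
    have co: "connected (f ` S)" by (rule connected_continuous_image[OF contf[OF that(3)] that(1)])
    have sub: "f ` S \<subseteq> inside ?K \<union> outside ?K"
      using that(2) injf[of UNIV] unfolding K(6) by (auto simp: inj_on_def)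
    have "inside ?K \<inter> f ` S = {} \<or> outside ?K \<inter> f ` S = {}"
      using connectedD[OF co K(1,3) _ sub] K(5) by blast
    with sub show ?thesis by blast
  qed
  have "f ` outside ?J \<subseteq> inside ?K \<or> f ` outside ?J \<subseteq> outside ?K"
    using side[OF J(4)] J(6) z0J by blast
  moreover have False if out: "f ` outside ?J \<subseteq> outside ?K"
  proof -
    have "connected (inside ?J - {z0})"
      by (rule connected_open_delete) (use J in auto)
    then have "f ` (inside ?J - {z0}) \<subseteq> inside ?K \<or> f ` (inside ?J - {z0}) \<subseteq> outside ?K"
      by (rule side) (use J(5,6) in blast)+
    moreover have "\<not> bounded (f ` (inside ?J - {z0}))"
    proof
      assume "bounded (f ` (inside ?J - {z0}))"
      then obtain B where B: "B > 0" "\<And>w. w \<in> f ` (inside ?J - {z0}) \<Longrightarrow> norm w \<le> B"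
        unfolding bounded_pos by blast
      obtain e where e: "e > 0" "ball z0 e \<subseteq> inside ?J"
        using J(1) z0 open_contains_ball by blast
      \<comment> \<open>The norm of \<open>f z\<close> is \<open>1 / r\<close>, which has to exceed
        \<open>B\<close>, while \<open>r < e\<close> keeps \<open>z\<close> in the inside.\<close>
      define r where "r = min (e/2) (1/(2*B))"
      have r: "r > 0" "r < e" "r \<le> 1/(2*B)" using e B by (auto simp: r_def)
      define z where "z = z0 + of_real r"
      have "z \<in> inside ?J - {z0}" using e r by (auto simp: z_def dist_norm)
      then have "norm (f z) \<le> B" using B by blast
      moreover have "norm (f z) = 1 / r" using r by (simp add: f_def z_def norm_divide inverse_eq_divide)
      moreover have "1 / r \<ge> 2 * B" using r B by (simp add: field_simps)
      ultimately show False using B by linarith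
    qed
    ultimately have ins: "f ` (inside ?J - {z0}) \<subseteq> outside ?K"
      using K(4) bounded_subset by blast
    have "y \<in> outside ?K" if "y \<noteq> 0" "y \<notin> ?K" for y
    proof -
      define z where "z = z0 + inverse y"
      have "f z = y" "z \<noteq> z0" using that by (auto simp: f_def z_def)
      moreover have "z \<notin> ?J" using that \<open>f z = y\<close> by blast
      ultimately show ?thesis using ins out J(6) by blast
    qed
    then have "inside ?K \<subseteq> {0}" using K(5,6) by blast
    then have "inside ?K = {0}" using K(2) by blast
    then show False using K(1) not_open_singleton by metis
  qed
  ultimately show ?thesis by blast
qed

text \<open>The inversion at a point inside the closed curve reduces this case to the previous one.\<close>

lemma interlacing_chords_outside:
  assumes c1: "arc c1" "pathstart c1 = s" "pathfinish c1 = t"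
    and c2: "arc c2" "pathstart c2 = s" "pathfinish c2 = t"
    and c: "arc c" "pathstart c = s" "pathfinish c = t"
    and c12: "path_image c1 \<inter> path_image c2 = {s, t}"
    and c1c: "path_image c1 \<inter> path_image c = {s, t}"
    and c2c: "path_image c2 \<inter> path_image c = {s, t}"
    and D: "connected D" "D \<inter> path_image c = {}"
    and p: "p \<in> path_image c1 - {s, t}" "p \<in> closure D"
    and q: "q \<in> path_image c2 - {s, t}" "q \<in> closure D"
    and chord_out: "arc_interior c \<subseteq> outside (path_image c1 \<union> path_image c2)"
    and D_out: "D \<subseteq> outside (path_image c1 \<union> path_image c2)"
  shows False
proof -
  define g where "g = c1 +++ reversepath c2"
  have g: "simple_path g" "pathfinish g = pathstart g" and img: "path_image g = path_image c1 \<union> path_image c2"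
    using c1 c2 c12 by (auto simp: g_def simple_path_join_loop_eq path_image_join arc_reversepath)
  have J: "inside (path_image g) \<noteq> {}" "inside (path_image g) \<inter> outside (path_image g) = {}"
     "inside (path_image g) \<union> outside (path_image g) = - path_image g"
     "frontier (outside (path_image g)) = path_image g"
    using Jordan_inside_outside[OF g] by blast+
  then obtain z0 where z0: "z0 \<in> inside (path_image g)" by blast
  define f where "f = (\<lambda>z. inverse (z - z0))"
  have fo: "f ` outside (path_image g) \<subseteq> inside (f ` path_image g)"
    using inversion_maps_outside_to_inside[OF g z0] by (simp add: f_def)
  have contf: "continuous_on S f" if "z0 \<notin> S" for S
    unfolding f_def by (intro continuous_intros) (use that in auto)
  have injf: "inj f"
    unfolding f_def inj_on_def by simp
  have z0n: "z0 \<notin> path_image g" "z0 \<notin> outside (path_image g)" using z0 J(2,3) by blast+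
  have z0c: "z0 \<notin> path_image c1" "z0 \<notin> path_image c2" "z0 \<notin> path_image c"
  proof -
    show "z0 \<notin> path_image c1" "z0 \<notin> path_image c2" using z0n img by auto
    moreover have "path_image c \<subseteq> arc_interior c \<union> path_image c1"
      using c c1c unfolding arc_interior_def by blast
    ultimately show "z0 \<notin> path_image c" using chord_out z0n img by auto
  qed
  have arc_f: "arc (f \<circ> h)" if "arc h" "z0 \<notin> path_image h" for h
    using that arc_simple_path[of h] arc_simple_path[of "f \<circ> h"] injf
       simple_path_continuous_image[of h f] contf[of "path_image h"]
    by (auto simp: pathstart_compose pathfinish_compose inj_eq inj_on_subset)
  \<comment> \<open>The point \<open>z0\<close> has to avoid the closure of \<open>D\<close>, where
    \<open>f\<close> must be continuous to carry \<open>p\<close> and \<open>q\<close> over as limit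
    points.\<close>
  have "closure D \<subseteq> closure (outside (path_image g))"
    using D_out img by (simp add: closure_mono)
  also have "\<dots> \<subseteq> outside (path_image g) \<union> path_image g"
    using J(4) by (simp add: closure_Un_frontier)
  finally have z0D: "z0 \<notin> closure D" using z0n by blast
  have clD: "f ` closure D \<subseteq> closure (f ` D)"
    by (rule image_closure_subset) (use contf[OF z0D] closure_subset[of "f ` D"] in auto)
  show False
  proof (rule interlacing_chords_inside[where ?c1.0 = "f \<circ> c1" and ?c2.0 = "f \<circ> c2" and c = "f \<circ> c" and s = "f s" and t = "f t"
        and D = "f ` D" and p = "f p" and q = "f q"])
    show "arc (f \<circ> c1)" "arc (f \<circ> c2)" "arc (f \<circ> c)" using arc_f c1 c2 c z0c by auto
    show "connected (f ` D)"
      using D(1) contf z0D closure_subset by (blast intro: connected_continuous_image)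
    show "path_image (f \<circ> c1) \<inter> path_image (f \<circ> c2) = {f s, f t}"
         "path_image (f \<circ> c1) \<inter> path_image (f \<circ> c) = {f s, f t}"
         "path_image (f \<circ> c2) \<inter> path_image (f \<circ> c) = {f s, f t}"
      using c12 c1c c2c by (simp_all add: path_image_compose flip: image_Int[OF injf])
    show "f ` D \<inter> path_image (f \<circ> c) = {}"
      using D(2) by (simp add: path_image_compose flip: image_Int[OF injf])
    show "f p \<in> path_image (f \<circ> c1) - {f s, f t}" "f q \<in> path_image (f \<circ> c2) - {f s, f t}"
      using p q injf by (auto simp: path_image_compose inj_eq)
    show "f p \<in> closure (f ` D)" "f q \<in> closure (f ` D)" using clD p q by auto
    have "path_image (f \<circ> c1) \<union> path_image (f \<circ> c2) = f ` path_image g"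
      by (simp add: img path_image_compose image_Un)
    moreover have "arc_interior (f \<circ> c) = f ` arc_interior c"
      unfolding arc_interior_def using injf c
      by (simp add: path_image_compose pathstart_compose pathfinish_compose image_set_diff)
    ultimately show "arc_interior (f \<circ> c) \<subseteq> inside (path_image (f \<circ> c1) \<union> path_image (f \<circ> c2))"
      "f ` D \<subseteq> inside (path_image (f \<circ> c1) \<union> path_image (f \<circ> c2))"
      using image_mono[OF chord_out, of f] image_mono[OF D_out, of f] fo img by simp_all
  qed (use c1 c2 c in \<open>auto simp: pathstart_compose pathfinish_compose\<close>)
qed

section \<open>K(3,3) as a hexagon with its three long diagonals\<close>

definition K33_arcs :: "complex set \<Rightarrow> complex set \<Rightarrow> (complex \<Rightarrow> complex \<Rightarrow> real \<Rightarrow> complex) \<Rightarrow> bool" where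
  "K33_arcs A B P \<longleftrightarrow>
     (\<forall>a\<in>A. \<forall>b\<in>B. arc (P a b) \<and> pathstart (P a b) = a \<and> pathfinish (P a b) = b) \<and>
     (\<forall>a\<in>A. \<forall>b\<in>B. \<forall>a'\<in>A. \<forall>b'\<in>B. (a, b) \<noteq> (a', b') \<longrightarrow>
        path_image (P a b) \<inter> path_image (P a' b') \<subseteq> {a, b} \<inter> {a', b'})"

text \<open>The arcs left out, \<open>P a1 b2\<close>, \<open>P a2 b3\<close> and
  \<open>P a3 b1\<close>, are the long diagonals.\<close>

definition hexagon where
  "hexagon P a1 b1 a2 b2 a3 b3 = path_image (P a1 b1) \<union> path_image (P a2 b1) \<union> path_image (P a2 b2) \<union>
     path_image (P a3 b2) \<union> path_image (P a3 b3) \<union> path_image (P a1 b3)"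

text \<open>Splitting the hexagon \<open>a1 b1 a2 b2 a3 b3\<close> at \<open>a1\<close> and \<open>b2\<close> puts \<open>a2\<close> and \<open>b3\<close> on different arcs.\<close>

lemma K33_chord_pair:
  assumes K: "K33_arcs A B P" and A: "A = {a1, a2, a3}" "distinct [a1, a2, a3]"
    and B: "B = {b1, b2, b3}" "distinct [b1, b2, b3]" and AB: "A \<inter> B = {}"
  shows "arc_interior (P a1 b2) \<inter> hexagon P a1 b1 a2 b2 a3 b3 = {}"
    "\<not> (arc_interior (P a1 b2) \<subseteq> inside (hexagon P a1 b1 a2 b2 a3 b3) \<and>
        arc_interior (P a2 b3) \<subseteq> inside (hexagon P a1 b1 a2 b2 a3 b3))" (is ?inside)
    "\<not> (arc_interior (P a1 b2) \<subseteq> outside (hexagon P a1 b1 a2 b2 a3 b3) \<and>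
        arc_interior (P a2 b3) \<subseteq> outside (hexagon P a1 b1 a2 b2 a3 b3))" (is ?outside)
    "\<exists>g. simple_path g \<and> pathfinish g = pathstart g \<and> path_image g = hexagon P a1 b1 a2 b2 a3 b3" (is ?loop)
proof -
  have arcs: "arc (P a b)" "pathstart (P a b) = a" "pathfinish (P a b) = b" if "a \<in> A" "b \<in> B" for a b
    using K that unfolding K33_arcs_def by auto
  have meet: "path_image (P a b) \<inter> path_image (P a' b') \<subseteq> {a, b} \<inter> {a', b'}"
    if "a \<in> A" "b \<in> B" "a' \<in> A" "b' \<in> B" "(a, b) \<noteq> (a', b')" for a b a' b'
    using K that unfolding K33_arcs_def by blast
  have ends: "a \<in> path_image (P a b)" "b \<in> path_image (P a b)" if "a \<in> A" "b \<in> B" for a b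
    using arcs[OF that] pathstart_in_path_image pathfinish_in_path_image by metis+
  have neq: "a1 \<noteq> a2" "a1 \<noteq> a3" "a2 \<noteq> a3" "b1 \<noteq> b2" "b1 \<noteq> b3" "b2 \<noteq> b3"
    "a1 \<noteq> b1" "a1 \<noteq> b2" "a1 \<noteq> b3" "a2 \<noteq> b1" "a2 \<noteq> b2" "a2 \<noteq> b3" "a3 \<noteq> b1" "a3 \<noteq> b2" "a3 \<noteq> b3"
    using A B AB by auto
  have int_eq: "path_image (P a b) \<inter> path_image (P a' b') = {a, b} \<inter> {a', b'}"
    if "a \<in> A" "b \<in> B" "a' \<in> A" "b' \<in> B" "(a, b) \<noteq> (a', b')" for a b a' b'
    using meet[OF that] ends[OF that(1,2)] ends[OF that(3,4)] by auto
  have mem: "a1 \<in> A" "a2 \<in> A" "a3 \<in> A" "b1 \<in> B" "b2 \<in> B" "b3 \<in> B" using A B by auto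
  let ?H = "hexagon P a1 b1 a2 b2 a3 b3"
  define c1 where "c1 = (P a1 b1 +++ reversepath (P a2 b1)) +++ P a2 b2"
  define c2 where "c2 = (P a1 b3 +++ reversepath (P a3 b3)) +++ P a3 b2"
  have c1': "arc (P a1 b1 +++ reversepath (P a2 b1))"
    by (rule arc_join) (use arcs mem neq meet[of a1 b1 a2 b1] in \<open>auto simp: arc_reversepath\<close>)
  have im1': "path_image (P a1 b1 +++ reversepath (P a2 b1)) = path_image (P a1 b1) \<union> path_image (P a2 b1)"
    using arcs mem by (simp add: path_image_join)
  have c1: "arc c1"
    unfolding c1_def
    by (rule arc_join[OF c1']) (use arcs mem neq meet[of a1 b1 a2 b2] meet[of a2 b1 a2 b2] im1' in auto)
  have im1: "path_image c1 = path_image (P a1 b1) \<union> path_image (P a2 b1) \<union> path_image (P a2 b2)"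
    unfolding c1_def using arcs mem im1' by (simp add: path_image_join)
  have c2': "arc (P a1 b3 +++ reversepath (P a3 b3))"
    by (rule arc_join) (use arcs mem neq meet[of a1 b3 a3 b3] in \<open>auto simp: arc_reversepath\<close>)
  have im2': "path_image (P a1 b3 +++ reversepath (P a3 b3)) = path_image (P a1 b3) \<union> path_image (P a3 b3)"
    using arcs mem by (simp add: path_image_join)
  have c2: "arc c2"
    unfolding c2_def
    by (rule arc_join[OF c2']) (use arcs mem neq meet[of a1 b3 a3 b2] meet[of a3 b3 a3 b2] im2' in auto)
  have im2: "path_image c2 = path_image (P a1 b3) \<union> path_image (P a3 b3) \<union> path_image (P a3 b2)"
    unfolding c2_def using arcs mem im2' by (simp add: path_image_join)
  have e1: "pathstart c1 = a1" "pathfinish c1 = b2" and e2: "pathstart c2 = a1" "pathfinish c2 = b2"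
    using arcs mem by (auto simp: c1_def c2_def)
  have H: "path_image c1 \<union> path_image c2 = ?H"
    unfolding im1 im2 hexagon_def by blast
  have c12: "path_image c1 \<inter> path_image c2 = {a1, b2}"
    unfolding im1 im2 Int_Un_distrib Int_Un_distrib2 using neq by (simp add: int_eq mem insert_commute)
  have c1c: "path_image c1 \<inter> path_image (P a1 b2) = {a1, b2}"
    unfolding im1 Int_Un_distrib Int_Un_distrib2 using neq by (simp add: int_eq mem insert_commute)
  have c2c: "path_image c2 \<inter> path_image (P a1 b2) = {a1, b2}"
    unfolding im2 Int_Un_distrib Int_Un_distrib2 using neq by (simp add: int_eq mem insert_commute)
  show "arc_interior (P a1 b2) \<inter> ?H = {}"
    unfolding arc_interior_def using arcs[of a1 b2] mem c1c c2c H by auto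
  show ?loop
    by (rule exI[of _ "c1 +++ reversepath c2"])
       (use c1 c2 e1 e2 c12 H in \<open>auto simp: simple_path_join_loop_eq path_image_join arc_reversepath\<close>)
  \<comment> \<open>The second diagonal without its ends serves as \<open>D\<close>; its ends
    \<open>a2\<close> on \<open>c1\<close> and \<open>b3\<close> on \<open>c2\<close> are in its
    closure.\<close>
  let ?D = "arc_interior (P a2 b3)"
  have D: "connected ?D" by (rule connected_arc_interior) (use arcs mem in auto)
  have Dc: "?D \<inter> path_image (P a1 b2) = {}"
    using meet[of a2 b3 a1 b2] neq mem unfolding arc_interior_def by auto
  have clD: "a2 \<in> closure ?D" "b3 \<in> closure ?D"
    using path_image_subset_closure_arc_interior[OF arcs(1)[of a2 b3]] ends[of a2 b3] mem by auto
  have p: "a2 \<in> path_image c1 - {a1, b2}" and q: "b3 \<in> path_image c2 - {a1, b2}"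
    using ends mem neq unfolding im1 im2 by auto
  show ?inside
    using interlacing_chords_inside[OF c1 e1 c2 e2 arcs[OF mem(1,5)] c12 c1c c2c D Dc p clD(1) q clD(2)] H by auto
  show ?outside
    using interlacing_chords_outside[OF c1 e1 c2 e2 arcs[OF mem(1,5)] c12 c1c c2c D Dc p clD(1) q clD(2)] H by auto
qed

lemma arc_interior_inside_or_outside:
  assumes "simple_path g" "pathfinish g = pathstart g" "arc c" "arc_interior c \<inter> path_image g = {}"
  shows "arc_interior c \<subseteq> inside (path_image g) \<or> arc_interior c \<subseteq> outside (path_image g)"
  using connectedD[OF connected_arc_interior[OF assms(3)], of "inside (path_image g)" "outside (path_image g)"]
    Jordan_inside_outside[OF assms(1,2)] assms(4) by blast

text \<open>A cyclic shift of the indices preserves the hexagon and turns the pair of diagonals in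
  \<open>K33_chord_pair\<close> into the other two pairs. So no two of the three diagonals share a
  side, although there are only two sides.\<close>

lemma K33_nonplanar:
  assumes K: "K33_arcs A B P" and "card A = 3" "card B = 3" "A \<inter> B = {}"
  shows False
proof -
  obtain a1 a2 a3 where A: "A = {a1, a2, a3}" "distinct [a1, a2, a3]"
    using \<open>card A = 3\<close> by (auto simp: card_3_iff)
  obtain b1 b2 b3 where B: "B = {b1, b2, b3}" "distinct [b1, b2, b3]"
    using \<open>card B = 3\<close> by (auto simp: card_3_iff)
  let ?H = "hexagon P a1 b1 a2 b2 a3 b3"
  have rot: "hexagon P a2 b2 a3 b3 a1 b1 = ?H" "hexagon P a3 b3 a1 b1 a2 b2 = ?H"
    unfolding hexagon_def by blast+
  have A': "A = {a2, a3, a1}" "distinct [a2, a3, a1]" "A = {a3, a1, a2}" "distinct [a3, a1, a2]" using A by auto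
  have B': "B = {b2, b3, b1}" "distinct [b2, b3, b1]" "B = {b3, b1, b2}" "distinct [b3, b1, b2]" using B by auto
  note chords = K33_chord_pair[OF K A B assms(4)]
    K33_chord_pair[OF K A'(1,2) B'(1,2) assms(4), unfolded rot]
    K33_chord_pair[OF K A'(3,4) B'(3,4) assms(4), unfolded rot]
  obtain g where g: "simple_path g" "pathfinish g = pathstart g" "path_image g = ?H"
    using chords by blast
  have "arc (P a1 b2)" "arc (P a2 b3)" "arc (P a3 b1)" using K A B unfolding K33_arcs_def by auto
  then show False
    using arc_interior_inside_or_outside[OF g(1,2), unfolded g(3)] chords by metis
qed

section \<open>Arcs as point sets, without parametrisation and orientation\<close>

definition arc_between :: "complex set \<Rightarrow> complex \<Rightarrow> complex \<Rightarrow> bool" where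
  "arc_between S x y \<longleftrightarrow> (\<exists>h. arc h \<and> pathstart h = x \<and> pathfinish h = y \<and> path_image h = S)"

lemma arc_between_sym: "arc_between S x y \<Longrightarrow> arc_between S y x"
  unfolding arc_between_def by (metis arc_reversepath pathfinish_reversepath pathstart_reversepath path_image_reversepath)

text \<open>The classes are indexed separately because they may be of different kinds: vertices of
  the graph, or points of the plane such as crossings. Edges and parts of edges enter as point
  sets.\<close>

lemma K33_nonplanar_indexed:
  assumes "card A = 3" "card B = 3" and inj: "inj_on \<alpha> A" "inj_on \<beta> B" "\<alpha> ` A \<inter> \<beta> ` B = {}"
    and arcs: "\<And>a b. a \<in> A \<Longrightarrow> b \<in> B \<Longrightarrow> arc_between (S a b) (\<alpha> a) (\<beta> b)"
    and meet: "\<And>a b a' b'. a \<in> A \<Longrightarrow> b \<in> B \<Longrightarrow> a' \<in> A \<Longrightarrow> b' \<in> B \<Longrightarrow> (a, b) \<noteq> (a', b') \<Longrightarrow>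
       S a b \<inter> S a' b' \<subseteq> {\<alpha> a, \<beta> b} \<inter> {\<alpha> a', \<beta> b'}"
  shows False
proof -
  have "\<exists>h. \<forall>a\<in>A. \<forall>b\<in>B. arc (h a b) \<and> pathstart (h a b) = \<alpha> a \<and> pathfinish (h a b) = \<beta> b \<and> path_image (h a b) = S a b"
    using arcs unfolding arc_between_def by metis
  then obtain h where h: "\<And>a b. a \<in> A \<Longrightarrow> b \<in> B \<Longrightarrow>
      arc (h a b) \<and> pathstart (h a b) = \<alpha> a \<and> pathfinish (h a b) = \<beta> b \<and> path_image (h a b) = S a b"
    by blast
  define P where "P x y = h (inv_into A \<alpha> x) (inv_into B \<beta> y)" for x y
  have P: "P (\<alpha> a) (\<beta> b) = h a b" if "a \<in> A" "b \<in> B" for a b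
    using that inj by (simp add: P_def)
  show False
  proof (rule K33_nonplanar)
    show "card (\<alpha> ` A) = 3" "card (\<beta> ` B) = 3" using assms by (auto simp: card_image)
    show "K33_arcs (\<alpha> ` A) (\<beta> ` B) P"
      unfolding K33_arcs_def
    proof (intro conjI ballI impI)
      fix x y assume "x \<in> \<alpha> ` A" "y \<in> \<beta> ` B"
      then show "arc (P x y)" "pathstart (P x y) = x" "pathfinish (P x y) = y"
        using P h by auto
    next
      fix x y x' y' assume "x \<in> \<alpha> ` A" "y \<in> \<beta> ` B" "x' \<in> \<alpha> ` A" "y' \<in> \<beta> ` B" "(x, y) \<noteq> (x', y')"
      then obtain a b a' b' where *: "a \<in> A" "b \<in> B" "a' \<in> A" "b' \<in> B" "(a, b) \<noteq> (a', b')"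
        "x = \<alpha> a" "y = \<beta> b" "x' = \<alpha> a'" "y' = \<beta> b'" by blast
      then show "path_image (P x y) \<inter> path_image (P x' y') \<subseteq> {x, y} \<inter> {x', y'}"
        using meet[OF *(1-5)] h P by simp
    qed
  qed (use inj in auto)
qed

lemma arc_split:
  assumes "arc c" "z \<in> arc_interior c"
  obtains S1 S2 where "arc_between S1 (pathstart c) z" "arc_between S2 (pathfinish c) z"
    "S1 \<union> S2 = path_image c" "S1 \<inter> S2 = {z}"
proof -
  obtain t where t: "t \<in> {0..1}" "c t = z" using assms by (auto simp: arc_interior_def path_image_def)
  moreover have "t \<noteq> 0" "t \<noteq> 1"
    using assms t unfolding arc_interior_def pathstart_def pathfinish_def by auto
  ultimately have t01: "0 < t" "t < 1" by auto
  have inj: "inj_on c {0..1}" using assms by (simp add: arc_def)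
  have "arc_between (c ` {0..t}) (c 0) z"
    unfolding arc_between_def using t t01 assms
    by (intro exI[of _ "subpath 0 t c"]) (auto simp: arc_subpath_arc path_image_subpath)
  moreover have "arc_between (c ` {t..1}) (c 1) z"
    using t t01 assms unfolding arc_between_def
    by (intro exI[of _ "subpath 1 t c"]) (auto simp: arc_subpath_arc path_image_subpath)
  moreover have "c ` {0..t} \<union> c ` {t..1} = path_image c"
    unfolding path_image_def image_Un[symmetric] using t01 by (simp add: ivl_disj_un_two_touch)
  moreover have "c ` {0..t} \<inter> c ` {t..1} = {z}"
  proof -
    have "c ` {0..t} \<inter> c ` {t..1} = c ` ({0..t} \<inter> {t..1})"
      by (rule inj_on_image_Int[OF inj, symmetric]) (use t01 in auto)
    also have "{0..t} \<inter> {t..1} = {t}" using t01 by auto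
    finally show ?thesis using t by simp
  qed
  ultimately show thesis by (rule that[unfolded pathstart_def pathfinish_def])
qed

subsection \<open>Crossings of 1-planar drawings\<close>

locale one_planar_graph =
  fixes V :: "'v set" and E p g
  assumes simple: "simple_graph V E" and one_planar: "one_planar_drawing V E p g"
begin

definition cross :: "'v set \<Rightarrow> 'v set \<Rightarrow> bool" where
  "cross e f \<longleftrightarrow> e \<in> E \<and> f \<in> E \<and> e \<noteq> f \<and> arc_interior (g e) \<inter> arc_interior (g f) \<noteq> {}"

lemma cross_sym: "cross e f \<Longrightarrow> cross f e"
  unfolding cross_def by blast

lemma edge: "e \<in> E \<Longrightarrow> e \<subseteq> V" "e \<in> E \<Longrightarrow> card e = 2"
  using simple unfolding simple_graph_def by auto

lemma drawing: "drawing V E p g"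
  using one_planar unfolding one_planar_drawing_def by (rule conjunct1)

lemma inj_p: "inj_on p V"
  using drawing unfolding drawing_def by (rule conjunct1)

lemma arc_edge:
  assumes "e \<in> E"
  shows "arc (g e)" "{pathstart (g e), pathfinish (g e)} = p ` e" "path_image (g e) \<inter> p ` V = p ` e"
proof -
  have "arc (g e) \<and> {pathstart (g e), pathfinish (g e)} = p ` e \<and> path_image (g e) \<inter> p ` V = p ` e"
    using drawing[unfolded drawing_def, THEN conjunct2] assms by (rule bspec)
  then show "arc (g e)" "{pathstart (g e), pathfinish (g e)} = p ` e" "path_image (g e) \<inter> p ` V = p ` e"
    by blast+
qed

lemma arc_interior_edge: "e \<in> E \<Longrightarrow> arc_interior (g e) = path_image (g e) - p ` V"
  unfolding arc_interior_def using arc_edge(2,3)[of e] by auto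

lemma arc_between_edge:
  assumes "{a, b} \<in> E" shows "arc_between (path_image (g {a, b})) (p a) (p b)"
proof -
  have "pathstart (g {a, b}) = p a \<and> pathfinish (g {a, b}) = p b \<or> pathstart (g {a, b}) = p b \<and> pathfinish (g {a, b}) = p a"
    using arc_edge(2)[OF assms] by (auto simp: doubleton_eq_iff)
  moreover have "arc_between (path_image (g {a, b})) (pathstart (g {a, b})) (pathfinish (g {a, b}))"
    unfolding arc_between_def using arc_edge(1)[OF assms] by blast
  ultimately show ?thesis using arc_between_sym by metis
qed

lemma cross_disjoint: "cross e f \<Longrightarrow> e \<inter> f = {}"
  using one_planar[unfolded one_planar_drawing_def, THEN conjunct2, THEN conjunct2] unfolding cross_def by auto

text \<open>\<open>crossings\<close> records pairs of an edge and a point, so its single bound makes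
  both the other edge and the point unique.\<close>

lemma crossing_unique:
  assumes "e \<in> E" "f \<in> E" "f \<noteq> e" "f' \<in> E" "f' \<noteq> e"
    "z \<in> arc_interior (g e) \<inter> arc_interior (g f)" "z' \<in> arc_interior (g e) \<inter> arc_interior (g f')"
  shows "f = f'" "z = z'"
proof -
  have fin: "finite (crossings E g e)" "card (crossings E g e) \<le> Suc 0"
    using one_planar[unfolded one_planar_drawing_def, THEN conjunct2, THEN conjunct1] assms(1) by auto
  then have all: "\<forall>x\<in>crossings E g e. \<forall>y\<in>crossings E g e. x = y"
    using card_le_Suc0_iff_eq by metis
  have mem: "(f, z) \<in> crossings E g e" "(f', z') \<in> crossings E g e"
    using assms unfolding crossings_def by auto
  have "(f, z) = (f', z')"
    by (rule bspec[OF bspec[OF all mem(1)] mem(2)])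
  then show "f = f'" "z = z'" by auto
qed

lemma cross_unique:
  assumes "cross e f" "cross e f'"
  shows "f = f'"
proof -
  obtain z z' where "z \<in> arc_interior (g e) \<inter> arc_interior (g f)"
      "z' \<in> arc_interior (g e) \<inter> arc_interior (g f')"
    using assms unfolding cross_def by blast
  moreover have "e \<in> E" "f \<in> E" "f \<noteq> e" "f' \<in> E" "f' \<noteq> e"
    using assms unfolding cross_def by auto
  ultimately show ?thesis by (intro crossing_unique(1)[of e f f' z z'])
qed

lemma edges_meet:
  assumes "e \<in> E" "f \<in> E" "e \<noteq> f" "\<not> cross e f"
  shows "path_image (g e) \<inter> path_image (g f) \<subseteq> p ` (e \<inter> f)"
proof
  fix z assume z: "z \<in> path_image (g e) \<inter> path_image (g f)"
  have "arc_interior (g e) \<inter> arc_interior (g f) = {}" using assms unfolding cross_def by simp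
  then have "z \<in> p ` V"
    using z arc_interior_edge[OF assms(1)] arc_interior_edge[OF assms(2)] by blast
  then have "z \<in> p ` e \<inter> p ` f"
    using z arc_edge(3)[OF assms(1)] arc_edge(3)[OF assms(2)] by blast
  then show "z \<in> p ` (e \<inter> f)"
    using inj_on_image_Int[OF inj_p edge(1)[OF assms(1)] edge(1)[OF assms(2)]] by simp
qed

text \<open>Edges with a common end never cross. So if no two disjoint edges between
  \<open>A\<close> and \<open>B\<close> crossed, these edges would form a plane K(3,3).\<close>

lemma K33_crossing:
  assumes A: "A \<subseteq> V" "card A = 3" and B: "B \<subseteq> V" "card B = 3" and AB: "A \<inter> B = {}"
    and E: "\<And>a b. a \<in> A \<Longrightarrow> b \<in> B \<Longrightarrow> {a, b} \<in> E"
  shows "\<exists>a\<in>A. \<exists>a'\<in>A. \<exists>b\<in>B. \<exists>b'\<in>B. a \<noteq> a' \<and> b \<noteq> b' \<and> cross {a, b} {a', b'}"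
proof (rule ccontr)
  assume neg: "\<not> ?thesis"
  then have no: "\<not> cross {a, b} {a', b'}" if "a \<in> A" "a' \<in> A" "a \<noteq> a'" "b \<in> B" "b' \<in> B" "b \<noteq> b'" for a a' b b'
    using neg that by blast
  show False
  proof (rule K33_nonplanar_indexed[where A = A and B = B and \<alpha> = p and \<beta> = p and S = "\<lambda>a b. path_image (g {a, b})"])
    show "inj_on p A" "inj_on p B" using inj_p A B by (auto intro: inj_on_subset)
    show "p ` A \<inter> p ` B = {}" using inj_on_image_Int[OF inj_p A(1) B(1)] AB by simp
    fix a b assume ab: "a \<in> A" "b \<in> B"
    show "arc_between (path_image (g {a, b})) (p a) (p b)" using arc_between_edge[OF E[OF ab]] .
    fix a' b' assume ab': "a' \<in> A" "b' \<in> B" "(a, b) \<noteq> (a', b')"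
    have "\<not> cross {a, b} {a', b'}"
    proof (cases "a = a' \<or> b = b'")
      case True then show ?thesis using cross_disjoint[of "{a, b}" "{a', b'}"] by auto
    next
      case False then show ?thesis using no ab ab' by blast
    qed
    moreover have "{a, b} \<noteq> {a', b'}" using ab ab' AB by (auto simp: doubleton_eq_iff)
    ultimately have "path_image (g {a, b}) \<inter> path_image (g {a', b'}) \<subseteq> p ` ({a, b} \<inter> {a', b'})"
      using edges_meet[of "{a, b}" "{a', b'}"] E[OF ab] E[OF ab'(1,2)] by simp
    then show "path_image (g {a, b}) \<inter> path_image (g {a', b'}) \<subseteq> {p a, p b} \<inter> {p a', p b'}"
      by blast
  qed (use A B in auto)
qed

section \<open>Crossing points as additional vertices\<close>

definition half_edges :: "'v set \<Rightarrow> complex \<Rightarrow> ('v \<Rightarrow> complex set) \<Rightarrow> bool" where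
  "half_edges e z H \<longleftrightarrow>
     (\<forall>a\<in>e. arc_between (H a) (p a) z \<and> H a \<subseteq> path_image (g e)) \<and>
     (\<forall>a\<in>e. \<forall>b\<in>e. a \<noteq> b \<longrightarrow> H a \<inter> H b = {z})"

lemma half_edges_exist:
  assumes e: "e \<in> E" and z: "z \<in> arc_interior (g e)"
  shows "\<exists>H. half_edges e z H"
proof -
  obtain u v where uv: "e = {u, v}" "pathstart (g e) = p u" "pathfinish (g e) = p v"
  proof -
    obtain u v where e_eq: "e = {u, v}" using edge(2)[OF e] by (auto simp: card_2_iff)
    then have "pathstart (g e) = p u \<and> pathfinish (g e) = p v \<or> pathstart (g e) = p v \<and> pathfinish (g e) = p u"
      using arc_edge(2)[OF e] by (auto simp: doubleton_eq_iff)
    then show thesis using that[of u v] that[of v u] e_eq by (auto simp: insert_commute)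
  qed
  have "u \<noteq> v" using arc_distinct_ends[OF arc_edge(1)[OF e]] uv by metis
  obtain S1 S2 where S: "arc_between S1 (p u) z" "arc_between S2 (p v) z" "S1 \<union> S2 = path_image (g e)" "S1 \<inter> S2 = {z}"
    using arc_split[OF arc_edge(1)[OF e] z] unfolding uv(2,3) .
  have "half_edges e z (\<lambda>a. if a = u then S1 else S2)"
    unfolding half_edges_def
  proof (intro conjI ballI impI)
    fix a b assume "a \<in> e" "b \<in> e" "a \<noteq> b"
    then have "a = u \<and> b = v \<or> a = v \<and> b = u" using uv(1) by blast
    then show "(if a = u then S1 else S2) \<inter> (if b = u then S1 else S2) = {z}"
      using S(4) \<open>u \<noteq> v\<close> by (metis Int_commute)
  next
    fix a assume "a \<in> e"
    then consider "a = u" | "a = v" "a \<noteq> u" using uv(1) by blast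
    then show "arc_between (if a = u then S1 else S2) (p a) z" "(if a = u then S1 else S2) \<subseteq> path_image (g e)"
      by (cases; use S in force)+
  qed
  then show ?thesis by blast
qed

lemma half_edgesD:
  assumes "half_edges e z H"
  shows "a \<in> e \<Longrightarrow> arc_between (H a) (p a) z" "a \<in> e \<Longrightarrow> H a \<subseteq> path_image (g e)"
    "a \<in> e \<Longrightarrow> b \<in> e \<Longrightarrow> a \<noteq> b \<Longrightarrow> H a \<inter> H b = {z}"
  using assms[unfolded half_edges_def] by simp_all

text \<open>Making the crossing point \<open>z\<close> a vertex turns two crossing edges into a star
  with four arms; \<open>H a\<close> is the arm from the end \<open>a\<close> to
  \<open>z\<close>.\<close>

definition crossing_star :: "'v set \<Rightarrow> 'v set \<Rightarrow> complex \<Rightarrow> ('v \<Rightarrow> complex set) \<Rightarrow> bool" where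
  "crossing_star e f z H \<longleftrightarrow>
     z \<in> arc_interior (g e) \<inter> arc_interior (g f) \<and>
     (\<forall>a\<in>e \<union> f. arc_between (H a) (p a) z) \<and>
     (\<forall>a\<in>e. H a \<subseteq> path_image (g e)) \<and> (\<forall>a\<in>f. H a \<subseteq> path_image (g f)) \<and>
     (\<forall>a\<in>e \<union> f. \<forall>b\<in>e \<union> f. a \<noteq> b \<longrightarrow> H a \<inter> H b = {z}) \<and>
     (\<forall>a\<in>e \<union> f. \<forall>v\<in>V. p v \<in> H a \<longrightarrow> v = a)"

lemma crossing_starD:
  assumes "crossing_star e f z H"
  shows "z \<in> arc_interior (g e) \<inter> arc_interior (g f)"
    "a \<in> e \<union> f \<Longrightarrow> arc_between (H a) (p a) z"
    "a \<in> e \<Longrightarrow> H a \<subseteq> path_image (g e)" "a \<in> f \<Longrightarrow> H a \<subseteq> path_image (g f)"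
    "a \<in> e \<union> f \<Longrightarrow> b \<in> e \<union> f \<Longrightarrow> a \<noteq> b \<Longrightarrow> H a \<inter> H b = {z}"
    "a \<in> e \<union> f \<Longrightarrow> v \<in> V \<Longrightarrow> p v \<in> H a \<Longrightarrow> v = a"
proof -
  have *: "z \<in> arc_interior (g e) \<inter> arc_interior (g f)"
     "\<forall>a\<in>e \<union> f. arc_between (H a) (p a) z"
     "\<forall>a\<in>e. H a \<subseteq> path_image (g e)" "\<forall>a\<in>f. H a \<subseteq> path_image (g f)"
     "\<forall>a\<in>e \<union> f. \<forall>b\<in>e \<union> f. a \<noteq> b \<longrightarrow> H a \<inter> H b = {z}"
     "\<forall>a\<in>e \<union> f. \<forall>v\<in>V. p v \<in> H a \<longrightarrow> v = a"
    using assms[unfolded crossing_star_def] by iprover+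
  show "z \<in> arc_interior (g e) \<inter> arc_interior (g f)" by (rule *(1))
  show "arc_between (H a) (p a) z" if "a \<in> e \<union> f" using *(2) that by (rule bspec)
  show "H a \<subseteq> path_image (g e)" if "a \<in> e" using *(3) that by (rule bspec)
  show "H a \<subseteq> path_image (g f)" if "a \<in> f" using *(4) that by (rule bspec)
  show "H a \<inter> H b = {z}" if "a \<in> e \<union> f" "b \<in> e \<union> f" "a \<noteq> b"
    using bspec[OF bspec[OF *(5) that(1)] that(2)] that(3) by (rule mp)
  show "v = a" if "a \<in> e \<union> f" "v \<in> V" "p v \<in> H a"
    using bspec[OF bspec[OF *(6) that(1)] that(2)] that(3) by (rule mp)
qed

lemma crossing_star_exists:
  assumes "cross e f"
  shows "\<exists>z H. crossing_star e f z H"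
proof -
  have ef: "e \<in> E" "f \<in> E" "e \<noteq> f" "e \<inter> f = {}" using assms cross_disjoint[OF assms] unfolding cross_def by auto
  obtain z where z: "z \<in> arc_interior (g e)" "z \<in> arc_interior (g f)" using assms unfolding cross_def by blast
  obtain H1 where eH1: "half_edges e z H1" using half_edges_exist[OF ef(1) z(1)] by blast
  obtain H2 where fH2: "half_edges f z H2" using half_edges_exist[OF ef(2) z(2)] by blast
  note H1 = half_edgesD[OF eH1] and H2 = half_edgesD[OF fH2]
  have zV: "z \<notin> p ` V" using z ef by (simp add: arc_interior_edge)
  have ends: "p a \<in> S \<and> z \<in> S" if "arc_between S (p a) z" for a S
    using that unfolding arc_between_def by (metis pathfinish_in_path_image pathstart_in_path_image)
  \<comment> \<open>Disjoint edges share no vertex, so a common point is interior to both, and there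
    is only one such point.\<close>
  have meet: "path_image (g e) \<inter> path_image (g f) \<subseteq> {z}"
  proof
    fix y assume y: "y \<in> path_image (g e) \<inter> path_image (g f)"
    then have "y \<notin> p ` V"
      using arc_edge(3)[OF ef(1)] arc_edge(3)[OF ef(2)] inj_on_image_Int[OF inj_p edge(1)[OF ef(1)] edge(1)[OF ef(2)]] ef(4)
      by blast
    then show "y \<in> {z}"
      using y ef z crossing_unique(2)[of e f f y z] by (auto simp: arc_interior_edge)
  qed
  define H where "H a = (if a \<in> e then H1 a else H2 a)" for a
  have H: "\<And>a. a \<in> e \<Longrightarrow> H a = H1 a" "\<And>a. a \<in> f \<Longrightarrow> H a = H2 a" using ef(4) by (auto simp: H_def)
  have "crossing_star e f z H"
    unfolding crossing_star_def
  proof (intro conjI ballI impI)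
    show arcH: "arc_between (H a) (p a) z" if "a \<in> e \<union> f" for a using that H H1(1) H2(1) by auto
    show He: "H a \<subseteq> path_image (g e)" if "a \<in> e" for a using that H H1 by auto
    show Hf: "H a \<subseteq> path_image (g f)" if "a \<in> f" for a using that H H2 by auto
    show Hab: "H a \<inter> H b = {z}" if ab: "a \<in> e \<union> f" "b \<in> e \<union> f" "a \<noteq> b" for a b
    proof -
      consider "a \<in> e" "b \<in> e" | "a \<in> f" "b \<in> f" | "a \<in> e" "b \<in> f" | "a \<in> f" "b \<in> e" using ab by blast
      then show ?thesis
      proof cases
        case 1 then show ?thesis using H H1(3) ab by simp
      next
        case 2 then show ?thesis using H H2(3) ab by simp
      next
        case 3 then show ?thesis using He[of a] Hf[of b] meet ends[OF arcH] ab by blast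
      next
        case 4 then show ?thesis using He[of b] Hf[of a] meet ends[OF arcH] ab by blast
      qed
    qed
    \<comment> \<open>A vertex on \<open>e\<close> or \<open>f\<close> is one of the four ends and
      lies on its own arm as well; two different arms share only \<open>z\<close>, which is no
      vertex.\<close>
    show "v = a" if a: "a \<in> e \<union> f" "v \<in> V" "p v \<in> H a" for a v
    proof (rule ccontr)
      assume "v \<noteq> a"
      have "p v \<in> p ` e \<union> p ` f"
        using a He[of a] Hf[of a] arc_edge(3)[OF ef(1)] arc_edge(3)[OF ef(2)] by blast
      then have "v \<in> e \<union> f"
        using inj_onD[OF inj_p _ a(2)] edge(1)[OF ef(1)] edge(1)[OF ef(2)] by fastforce
      then have "p v \<in> {z}" using Hab[of v a] ends[OF arcH, of v] \<open>v \<noteq> a\<close> a by blast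
      then show False using zV a by blast
    qed
  qed (use z in auto)
  then show ?thesis by blast
qed

text \<open>The edges \<open>e\<close> and \<open>f\<close> have spent their only crossing on each
  other. So \<open>h\<close> can meet them in common vertices only, and the arm of \<open>a\<close>
  contains no vertex but \<open>a\<close>.\<close>

lemma crossing_star_meets_edge:
  assumes c: "cross e f" and H: "crossing_star e f z H" and a: "a \<in> e \<union> f"
    and h: "h \<in> E" "h \<noteq> e" "h \<noteq> f" and y: "y \<in> H a" "y \<in> path_image (g h)"
  shows "a \<in> h \<and> y = p a"
proof -
  obtain x where x: "x \<in> E" "x \<noteq> h" "\<not> cross x h" "y \<in> path_image (g x)"
  proof (cases "a \<in> e")
    case True
    have "\<not> cross e h" using cross_unique[OF c, of h] h(3) by auto
    then show thesis
      using that[of e] h(2) subsetD[OF crossing_starD(3)[OF H True] y(1)] c unfolding cross_def by auto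
  next
    case False
    then have "a \<in> f" using a by simp
    moreover have "\<not> cross f h" using cross_unique[OF cross_sym[OF c], of h] h(2) by auto
    ultimately show thesis
      using that[of f] h(3) subsetD[OF crossing_starD(4)[OF H] y(1)] c unfolding cross_def by auto
  qed
  then have "y \<in> p ` (x \<inter> h)"
    using edges_meet[OF x(1) h(1) x(2,3)] y(2) by blast
  then obtain v where v: "v \<in> x" "v \<in> h" "y = p v" by blast
  then have "v = a" using crossing_starD(6)[OF H a, of v] edge(1)[OF h(1)] y(1) by blast
  then show ?thesis using v by simp
qed

text \<open>The plane \<open>K\<^sub>3\<^sub>,\<^sub>3\<close> has the classes \<open>T\<close> and the two crossing points together with \<open>w\<close>.\<close>

lemma crossings_sharing_three:
  assumes c: "cross e f" and c': "cross e' f'" and ne: "e \<noteq> e'" "e \<noteq> f'"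
    and T: "T \<subseteq> e \<union> f" "T \<subseteq> e' \<union> f'" "card T = 3"
    and w: "w \<in> V" "w \<notin> e \<union> f" "w \<notin> e' \<union> f'" "\<And>a. a \<in> T \<Longrightarrow> {a, w} \<in> E"
  shows False
proof -
  obtain z H where zH: "crossing_star e f z H" using crossing_star_exists[OF c] by blast
  note z = crossing_starD(1)[OF zH] and H = crossing_starD(2-)[OF zH]
  obtain z' H' where zH': "crossing_star e' f' z' H'" using crossing_star_exists[OF c'] by blast
  note z' = crossing_starD(1)[OF zH'] and H' = crossing_starD(2-)[OF zH']
  have E: "e \<in> E" "f \<in> E" "e' \<in> E" "f' \<in> E" using c c' unfolding cross_def by auto
  have only: "y = f" if "cross e y" for y using cross_unique[OF c that] by simp
  have only': "y = e" if "cross f y" for y using cross_unique[OF cross_sym[OF c] that] by simp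
  have only2: "y = f'" if "cross e' y" for y using cross_unique[OF c' that] by simp
  have only2': "y = e'" if "cross f' y" for y using cross_unique[OF cross_sym[OF c'] that] by simp
  \<comment> \<open>Crossing partners are unique, so the two crossings share no edge at all.\<close>
  have fne: "f \<noteq> e'" "f \<noteq> f'" using only2[of e] only2'[of e] cross_sym[OF c] ne by auto
  have nc: "\<not> cross x y" if "x \<in> {e, f}" "y \<in> {e', f'}" for x y
    using that ne fne only[of y] only'[of y] by auto
  have zV: "z \<notin> p ` V" "z' \<notin> p ` V" using z z' E by (auto simp: arc_interior_edge)
  have TV: "T \<subseteq> V" using T(1) edge(1)[OF E(1)] edge(1)[OF E(2)] by blast
  have zz': "z \<noteq> z'"
  proof
    assume "z = z'"
    then have "cross e e'" using z z' E ne unfolding cross_def by blast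
    then show False using nc[of e e'] by simp
  qed
  have wT: "w \<notin> T" using w T by blast
  \<comment> \<open>The lemma \<open>crossing_star_meets_edge\<close> applies both ways: the arm at
    \<open>z\<close> meets \<open>e'\<close> and \<open>f'\<close> at most in \<open>p a\<close>,
    and the arm at \<open>z'\<close> meets \<open>e\<close> and \<open>f\<close> at most in
    \<open>p b\<close>.\<close>
  have HH': "H a \<inter> H' b \<subseteq> {p a} \<inter> {p b}" if ab: "a \<in> T" "b \<in> T" for a b
  proof
    fix y assume y: "y \<in> H a \<inter> H' b"
    have ef: "a \<in> e \<union> f" "b \<in> e' \<union> f'" using ab T by auto
    have y1: "y \<in> path_image (g e) \<or> y \<in> path_image (g f)"
      using crossing_starD(3,4)[OF zH, of a] ef(1) y by blast
    have y2: "y \<in> path_image (g e') \<or> y \<in> path_image (g f')"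
      using crossing_starD(3,4)[OF zH', of b] ef(2) y by blast
    have "y = p a"
      using y2 crossing_star_meets_edge[OF c zH ef(1) E(3), of y] crossing_star_meets_edge[OF c zH ef(1) E(4), of y] y ne fne
      by auto
    moreover have "y = p b"
      using y1 crossing_star_meets_edge[OF c' zH' ef(2) E(1), of y] crossing_star_meets_edge[OF c' zH' ef(2) E(2), of y] y ne fne
      by auto
    ultimately show "y \<in> {p a} \<inter> {p b}" by simp
  qed
  have Hw: "H a \<inter> path_image (g {b, w}) \<subseteq> {p a} \<inter> {p b}" if ab: "a \<in> T" "b \<in> T" for a b
  proof
    fix y assume y: "y \<in> H a \<inter> path_image (g {b, w})"
    have "a \<in> e \<union> f" "{b, w} \<noteq> e" "{b, w} \<noteq> f" using ab w(2) T by auto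
    then have "a \<in> {b, w} \<and> y = p a"
      using crossing_star_meets_edge[OF c zH, of a "{b, w}" y] w(4)[OF ab(2)] y by auto
    then show "y \<in> {p a} \<inter> {p b}" using wT ab by auto
  qed
  have H'w: "H' a \<inter> path_image (g {b, w}) \<subseteq> {p a} \<inter> {p b}" if ab: "a \<in> T" "b \<in> T" for a b
  proof
    fix y assume y: "y \<in> H' a \<inter> path_image (g {b, w})"
    have "a \<in> e' \<union> f'" "{b, w} \<noteq> e'" "{b, w} \<noteq> f'" using ab w(3) T by auto
    then have "a \<in> {b, w} \<and> y = p a"
      using crossing_star_meets_edge[OF c' zH', of a "{b, w}" y] w(4)[OF ab(2)] y by auto
    then show "y \<in> {p a} \<inter> {p b}" using wT ab by auto
  qed
  have ww: "path_image (g {a, w}) \<inter> path_image (g {b, w}) \<subseteq> {p w}" if ab: "a \<in> T" "b \<in> T" "a \<noteq> b" for a b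
  proof -
    have "\<not> cross {a, w} {b, w}" using cross_disjoint[of "{a, w}" "{b, w}"] by auto
    moreover have "{a, w} \<noteq> {b, w}" "{a, w} \<inter> {b, w} = {w}" using ab wT by (auto simp: doubleton_eq_iff)
    ultimately show ?thesis using edges_meet[of "{a, w}" "{b, w}"] w(4) ab by auto
  qed
  \<comment> \<open>The three arcs of the K(3,3) at \<open>a\<close> are its arm to
    \<open>z\<close>, its arm to \<open>z'\<close> and its edge to \<open>w\<close>.\<close>
  define S where "S a b = (if b = z then H a else if b = z' then H' a else path_image (g {a, w}))" for a b
  have S: "S a z = H a" "S a z' = H' a" "S a (p w) = path_image (g {a, w})" for a
    using zz' zV w(1) by (auto simp: S_def)
  have pw: "p w \<noteq> z" "p w \<noteq> z'" using zV w(1) by auto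
  show False
  proof (rule K33_nonplanar_indexed[where A = T and B = "{z, z', p w}" and \<alpha> = p and \<beta> = id and S = S])
    show "card {z, z', p w} = 3" using zz' pw by simp
    show "inj_on p T" using inj_p TV by (rule inj_on_subset)
    show "p ` T \<inter> id ` {z, z', p w} = {}" using zV TV wT inj_on_image_mem_iff[OF inj_p w(1) TV] by auto
    fix a b assume ab: "a \<in> T" "b \<in> {z, z', p w}"
    show "arc_between (S a b) (p a) (id b)"
      using ab(2) H(1)[OF subsetD[OF T(1) ab(1)]] H'(1)[OF subsetD[OF T(2) ab(1)]]
        arc_between_edge[OF w(4)[OF ab(1)]] S
      by (elim insertE emptyE) simp_all
    fix a' b' assume ab': "a' \<in> T" "b' \<in> {z, z', p w}" "(a, b) \<noteq> (a', b')"
    have HH: "H a \<inter> H a' \<subseteq> {z}" if "a \<noteq> a'" using H(4)[OF subsetD[OF T(1) ab(1)] subsetD[OF T(1) ab'(1)] that] by simp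
    have HH2: "H' a \<inter> H' a' \<subseteq> {z'}" if "a \<noteq> a'" using H'(4)[OF subsetD[OF T(2) ab(1)] subsetD[OF T(2) ab'(1)] that] by simp
    note HHs = HH'[OF ab(1) ab'(1)] HH'[OF ab'(1) ab(1)] Hw[OF ab(1) ab'(1)] Hw[OF ab'(1) ab(1)]
      H'w[OF ab(1) ab'(1)] H'w[OF ab'(1) ab(1)]
    consider "b = z" "b' = z" | "b = z" "b' = z'" | "b = z" "b' = p w"
      | "b = z'" "b' = z" | "b = z'" "b' = z'" | "b = z'" "b' = p w"
      | "b = p w" "b' = z" | "b = p w" "b' = z'" | "b = p w" "b' = p w"
      using ab(2) ab'(2) by auto
    then show "S a b \<inter> S a' b' \<subseteq> {p a, id b} \<inter> {p a', id b'}"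
    proof cases
      case 1 then show ?thesis using HH ab'(3) by (simp add: S) blast
    next
      case 2 then show ?thesis using HHs(1) by (simp add: S) blast
    next
      case 3 then show ?thesis using HHs(3) by (simp add: S) blast
    next
      case 4 then show ?thesis using HHs(2) by (simp add: S) blast
    next
      case 5 then show ?thesis using HH2 ab'(3) by (simp add: S) blast
    next
      case 6 then show ?thesis using HHs(5) by (simp add: S) blast
    next
      case 7 then show ?thesis using HHs(4) by (simp add: S) blast
    next
      case 8 then show ?thesis using HHs(6) by (simp add: S) blast
    next
      case 9 then show ?thesis using ww[OF ab(1) ab'(1)] ab'(3) by (simp add: S) blast
    qed
  qed (use T in auto)
qed

subsection \<open>Complete graphs on six vertices\<close>

definition misses :: "'v set \<Rightarrow> 'v \<Rightarrow> 'v \<Rightarrow> bool" where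
  "misses W x y \<longleftrightarrow> x \<in> W \<and> y \<in> W \<and> x \<noteq> y \<and> (\<exists>e f. cross e f \<and> e \<union> f = W - {x, y})"

lemma misses_sym: "misses W x y \<Longrightarrow> misses W y x"
  unfolding misses_def by (auto simp: insert_commute)

definition clique :: "'v set \<Rightarrow> bool" where
  "clique W \<longleftrightarrow> W \<subseteq> V \<and> (\<forall>x\<in>W. \<forall>y\<in>W. x \<noteq> y \<longrightarrow> {x, y} \<in> E)"

text \<open>Each edge has at most one crossing partner, so different crossings have no edge in
  common.\<close>

lemma distinct_crossings:
  assumes c: "cross e f" and c': "cross e' f'" and neq: "{e, f} \<noteq> {e', f'}"
  shows "e \<noteq> e'" "e \<noteq> f'"
proof -
  show "e \<noteq> e'"
  proof
    assume "e = e'"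
    then have "f = f'" using cross_unique[OF c, of f'] c' by simp
    then show False using neq \<open>e = e'\<close> by simp
  qed
  show "e \<noteq> f'"
  proof
    assume "e = f'"
    then have "f = e'" using cross_unique[OF c, of e'] cross_sym[OF c'] by simp
    then show False using neq \<open>e = f'\<close> by (simp add: insert_commute)
  qed
qed

lemma card_crossing:
  assumes "cross e f"
  shows "card (e \<union> f) = 4"
proof -
  have "card e = 2" "card f = 2" using edge(2)[of e] edge(2)[of f] assms unfolding cross_def by simp_all
  moreover from this have "finite e" "finite f" by (auto intro: card_ge_0_finite)
  ultimately show ?thesis using card_Un_disjoint[OF _ _ cross_disjoint[OF assms]] by simp
qed

text \<open>Two crossings on the same four vertices would share any three of them, and
  \<open>w\<close> is adjacent to all four.\<close>

lemma crossing_on_same_vertices_unique: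
  assumes c: "cross e f" and c': "cross e' f'" and eq: "e \<union> f = e' \<union> f'"
    and w: "w \<in> V" "w \<notin> e \<union> f" "\<And>a. a \<in> e \<union> f \<Longrightarrow> {a, w} \<in> E"
  shows "{e, f} = {e', f'}"
proof (rule ccontr)
  assume neq: "{e, f} \<noteq> {e', f'}"
  have "3 \<le> card (e \<union> f)" using card_crossing[OF c] by simp
  then obtain T where T: "T \<subseteq> e \<union> f" "card T = 3"
    by (rule obtain_subset_with_card_n)
  show False
    by (rule crossings_sharing_three[OF c c' distinct_crossings[OF c c' neq] T(1) _ T(2) w(1,2) _ w(3)])
       (use T(1) w(2) eq in auto)
qed

text \<open>Crossings that leave over \<open>x\<close>, \<open>y\<close> and \<open>x\<close>,
  \<open>z\<close> would both use the other three vertices of \<open>W\<close>, and \<open>x\<close>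
  is adjacent to all three.\<close>

lemma misses_unique:
  assumes W: "clique W" "card W = 6" and m: "misses W x y" "misses W x z"
  shows "y = z"
proof (rule ccontr)
  assume yz: "y \<noteq> z"
  obtain e f where ef: "cross e f" "e \<union> f = W - {x, y}" using m(1) unfolding misses_def by blast
  obtain e' f' where ef': "cross e' f'" "e' \<union> f' = W - {x, z}" using m(2) unfolding misses_def by blast
  have in_W: "x \<in> W" "y \<in> W" "z \<in> W" "x \<noteq> y" "x \<noteq> z" using m unfolding misses_def by auto
  have neq: "e \<union> f \<noteq> e' \<union> f'" using ef ef' in_W yz by blast
  then have "{e, f} \<noteq> {e', f'}" using arg_cong[of "{e, f}" "{e', f'}" Union] by auto
  note ne = distinct_crossings[OF ef(1) ef'(1) this]
  have "card (W - {x, y, z}) = 3"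
    using W(2) in_W yz by (auto simp: card_Diff_subset card_insert_if)
  moreover have "W - {x, y, z} \<subseteq> e \<union> f" "W - {x, y, z} \<subseteq> e' \<union> f'" using ef ef' by auto
  moreover have "x \<in> V" "x \<notin> e \<union> f" "x \<notin> e' \<union> f'" using ef ef' in_W W unfolding clique_def by auto
  moreover have "{a, x} \<in> E" if "a \<in> W - {x, y, z}" for a
    using W(1) that in_W unfolding clique_def by auto
  ultimately show False
    using crossings_sharing_three[OF ef(1) ef'(1) ne, of "W - {x, y, z}" x] by blast
qed

text \<open>A crossing inside the K(3,3) between two triples uses two vertices of each triple and
  leaves over one of each. So every split of \<open>W\<close> into triples separates some missed
  pair.\<close>

lemma split_crossing:
  assumes W: "clique W" and AB: "W = {a1, a2, a3, b1, b2, b3}" "distinct [a1, a2, a3, b1, b2, b3]"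
  obtains a a' a'' b b' b'' where "a \<in> {a1, a2, a3}" "{a', a''} = {a1, a2, a3} - {a}"
    "b \<in> {b1, b2, b3}" "{b', b''} = {b1, b2, b3} - {b}"
    "misses W a b" "cross {a', b'} {a'', b''}"
proof -
  let ?A = "{a1, a2, a3}" and ?B = "{b1, b2, b3}"
  have "\<exists>a\<in>?A. \<exists>a'\<in>?A. \<exists>b\<in>?B. \<exists>b'\<in>?B. a \<noteq> a' \<and> b \<noteq> b' \<and> cross {a, b} {a', b'}"
    by (rule K33_crossing) (use W AB in \<open>auto simp: clique_def\<close>)
  then obtain a' a'' b' b'' where x: "a' \<in> ?A" "a'' \<in> ?A" "b' \<in> ?B" "b'' \<in> ?B" "a' \<noteq> a''" "b' \<noteq> b''"
    and c: "cross {a', b'} {a'', b''}" by blast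
  have third: "\<exists>z\<in>A. {x, y} = A - {z}" if "card A = 3" "x \<in> A" "y \<in> A" "x \<noteq> y" for x y :: 'v and A
  proof -
    have "card (A - {x, y}) = 1" using that by (auto simp: card_Diff_subset)
    then obtain z where "A - {x, y} = {z}" by (rule card_1_singletonE)
    then show ?thesis using that by (intro bexI[of _ z]) blast+
  qed
  have card3: "card ?A = 3" "card ?B = 3" using AB(2) by auto
  obtain a where a: "a \<in> ?A" "{a', a''} = ?A - {a}"
    using third[OF card3(1) x(1,2,5)] by blast
  obtain b where b: "b \<in> ?B" "{b', b''} = ?B - {b}"
    using third[OF card3(2) x(3,4,6)] by blast
  have W_eq: "W = ?A \<union> ?B" using AB(1) by auto
  have disj: "?A \<inter> ?B = {}" using AB(2) by auto
  have "{a', b'} \<union> {a'', b''} = {a', a''} \<union> {b', b''}" by auto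
  also have "\<dots> = W - {a, b}"
    using disj a(1) b(1) unfolding a(2) b(2) W_eq by blast
  finally have "{a', b'} \<union> {a'', b''} = W - {a, b}" .
  moreover have "a \<in> W" "b \<in> W" using a(1) b(1) W_eq by blast+
  moreover have "a \<noteq> b" using a(1) b(1) disj by blast
  ultimately have "misses W a b" using c unfolding misses_def by blast
  then show thesis by (rule that[OF a b _ c])
qed

text \<open>Split \<open>W\<close> into \<open>v\<close>, \<open>x\<close>, \<open>y\<close> and the
  rest. The missed pair separated by this split contains neither \<open>x\<close> nor
  \<open>y\<close>, which are paired with each other, so it contains \<open>v\<close>.\<close>

lemma misses_extend:
  assumes W: "clique W" "card W = 6" and m: "misses W x y" and v: "v \<in> W - {x, y}"
  obtains w where "misses W v w" "w \<notin> {v, x, y}"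
proof -
  have xy: "x \<in> W" "y \<in> W" "x \<noteq> y" using m unfolding misses_def by auto
  have "card (W - {v, x, y}) = 3"
    using W(2) xy v by (auto simp: card_Diff_subset card_insert_if)
  then obtain r1 r2 r3 where r: "W - {v, x, y} = {r1, r2, r3}" "distinct [r1, r2, r3]"
    by (auto simp: card_3_iff)
  have Wr: "W = {v, x, y, r1, r2, r3}" "distinct [v, x, y, r1, r2, r3]"
    using r xy v by auto
  obtain a a' a'' b b' b'' where *: "a \<in> {v, x, y}" "b \<in> {r1, r2, r3}" "misses W a b"
    by (rule split_crossing[OF W(1) Wr])
  have b: "b \<in> W - {v, x, y}" using *(2) r by auto
  have "a \<noteq> x" using misses_unique[OF W m, of b] *(3) b by auto
  moreover have "a \<noteq> y" using misses_unique[OF W misses_sym[OF m], of b] *(3) b by auto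
  ultimately have "a = v" using *(1) by simp
  then show thesis using that[of b] *(3) b by simp
qed

text \<open>The split into \<open>s\<close>, \<open>s'\<close>, \<open>r\<close> and
  \<open>t\<close>, \<open>t'\<close>, \<open>r'\<close> separates only the last of the three missed
  pairs. So its crossing leaves over \<open>r\<close>, \<open>r'\<close>, and its edges join
  \<open>s\<close>, \<open>s'\<close> to \<open>t\<close>, \<open>t'\<close>.\<close>

lemma missing_pairs_crossing:
  assumes W: "clique W" "card W = 6"
    and st: "W = {s, s', t, t', r, r'}" "distinct [s, s', t, t', r, r']"
    and m: "misses W s s'" "misses W t t'" "misses W r r'"
  shows "cross {s, t} {s', t'} \<or> cross {s, t'} {s', t}"
proof -
  obtain x x' x'' y y' y'' where x: "x \<in> {s, s', r}" "{x', x''} = {s, s', r} - {x}"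
      and y: "y \<in> {t, t', r'}" "{y', y''} = {t, t', r'} - {y}"
      and m_xy: "misses W x y" and c: "cross {x', y'} {x'', y''}"
    by (rule split_crossing[OF W(1), of s s' r t t' r']) (use st in auto)
  have "x \<noteq> s" using misses_unique[OF W m(1), of y] m_xy y(1) st(2) by auto
  moreover have "x \<noteq> s'" using misses_unique[OF W misses_sym[OF m(1)], of y] m_xy y(1) st(2) by auto
  ultimately have x_eq: "x = r" using x(1) by simp
  have y_eq: "y = r'" using misses_unique[OF W m(3), of y] m_xy x_eq by simp
  have "{x', x''} = {s, s'}" "{y', y''} = {t, t'}"
    using x(2) y(2) st(2) unfolding x_eq y_eq by auto
  then show ?thesis using c cross_sym[OF c] by (auto simp: doubleton_eq_iff)
qed

text \<open>The missed pairs are \<open>v\<close>, \<open>q\<close> and \<open>a\<close>,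
  \<open>b\<close> and \<open>c\<close>, \<open>d\<close>; within the last two the names are chosen
  such that \<open>v\<close> is joined to \<open>a\<close> and to \<open>c\<close>. Prescribing
  \<open>v\<close> allows \<open>two_K6_sharing_K5\<close> to take the vertex outside the common
  K5.\<close>

lemma K6_crossings:
  assumes W: "clique W" "card W = 6" and v: "v \<in> W"
  obtains q a b c d where "W = {v, q, a, b, c, d}" "distinct [v, q, a, b, c, d]"
    "cross {v, a} {q, b}" "cross {v, c} {q, d}" "cross {a, d} {b, c}"
proof -
  have "\<exists>x y. misses W x y"
  proof -
    have "finite W" using W(2) by (simp add: card_ge_0_finite)
    then obtain xs where xs: "set xs = W" "distinct xs" using finite_distinct_list by blast
    then have "length xs = 6" using W(2) distinct_card by fastforce
    then obtain a1 a2 a3 b1 b2 b3 where xs_eq: "xs = [a1, a2, a3, b1, b2, b3]"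
      by (auto simp: numeral_eq_Suc length_Suc_conv)
    show ?thesis by (rule split_crossing[OF W(1), of a1 a2 a3 b1 b2 b3]) (use xs xs_eq in auto)
  qed
  then obtain x y where xy: "misses W x y" by blast
  obtain q where q: "misses W v q"
  proof (cases "v \<in> {x, y}")
    case True
    then show thesis using that[of x] that[of y] xy misses_sym[OF xy] by auto
  next
    case False
    then show thesis using misses_extend[OF W xy, of v] that v by blast
  qed
  have qW: "q \<in> W" "q \<noteq> v" using q unfolding misses_def by auto
  have "card (W - {v, q}) = 4" using W(2) v qW by (auto simp: card_Diff_subset card_insert_if)
  then obtain a0 where a0: "a0 \<in> W - {v, q}" by (metis all_not_in_conv card.empty zero_neq_numeral)
  obtain b0 where b0: "misses W a0 b0" "b0 \<notin> {a0, v, q}" using misses_extend[OF W q a0] by blast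
  have b0W: "b0 \<in> W" using b0 unfolding misses_def by auto
  have "card (W - {v, q, a0, b0}) = 2" using W(2) v qW a0 b0 b0W by (auto simp: card_Diff_subset card_insert_if)
  then obtain c0 d0 where cd0: "W - {v, q, a0, b0} = {c0, d0}" "c0 \<noteq> d0" by (auto simp: card_2_iff)
  have W0: "W = {v, q, a0, b0, c0, d0}" "distinct [v, q, a0, b0, c0, d0]"
    using cd0 v qW a0 b0(2) b0W by auto
  have "c0 \<in> W - {a0, b0}" using W0 by auto
  then obtain t where t: "misses W c0 t" "t \<notin> {c0, a0, b0}" using misses_extend[OF W b0(1)] by blast
  have "t \<noteq> v" using misses_unique[OF W q, of c0] misses_sym[OF t(1)] W0(2) by auto
  moreover have "t \<noteq> q" using misses_unique[OF W misses_sym[OF q], of c0] misses_sym[OF t(1)] W0(2) by auto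
  moreover have "t \<in> W" using t(1) unfolding misses_def by simp
  ultimately have "t = d0" using t(2) W0(1) by blast
  then have m_cd0: "misses W c0 d0" using t by simp
  obtain a b where ab: "misses W a b" "{a, b} = {a0, b0}" "cross {v, a} {q, b}"
  proof -
    have "cross {v, a0} {q, b0} \<or> cross {v, b0} {q, a0}"
      by (rule missing_pairs_crossing[OF W W0 q b0(1) m_cd0])
    then show thesis using that[OF b0(1) refl] that[OF misses_sym[OF b0(1)] insert_commute] by blast
  qed
  obtain c d where cd: "misses W c d" "{c, d} = {c0, d0}" "cross {v, c} {q, d}"
  proof -
    have "cross {v, c0} {q, d0} \<or> cross {v, d0} {q, c0}"
      by (rule missing_pairs_crossing[OF W _ _ q m_cd0 b0(1)]) (use W0 in auto)
    then show thesis using that[OF m_cd0 refl] that[OF misses_sym[OF m_cd0] insert_commute] by blast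
  qed
  have Wab: "W = {v, q} \<union> {a, b} \<union> {c, d}" unfolding ab(2) cd(2) W0(1) by auto
  have W_eq: "W = {v, q, a, b, c, d}" using Wab by auto
  moreover have "card {v, q, a, b, c, d} = 6" using W(2) W_eq by simp
  then have dist: "distinct [v, q, a, b, c, d]"
    by (intro card_distinct) simp
  have unique: "{e, f} = {e', f'}" if "cross e f" "cross e' f'" "e \<union> f = e' \<union> f'" "e \<union> f \<subseteq> W" "w \<in> W" "w \<notin> e \<union> f" for e f e' f' w
    by (rule crossing_on_same_vertices_unique[OF that(1-3), of w]) (use that W in \<open>auto simp: clique_def\<close>)
  \<comment> \<open>The split into \<open>v\<close>, \<open>a\<close>, \<open>c\<close> and
    \<open>q\<close>, \<open>b\<close>, \<open>d\<close> separates all three missed pairs. Its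
    crossing leaves over one of them, and only \<open>v\<close>, \<open>q\<close> turns out to be
    possible.\<close>
  have "cross {a, d} {b, c}"
  proof -
    obtain x x' x'' y y' y'' where x: "x \<in> {v, a, c}" "{x', x''} = {v, a, c} - {x}"
        and y: "y \<in> {q, b, d}" "{y', y''} = {q, b, d} - {y}"
        and m_xy: "misses W x y" and cr: "cross {x', y'} {x'', y''}"
      by (rule split_crossing[OF W(1), of v a c q b d]) (use W_eq dist in auto)
    consider "x = v" "y = q" | "x = a" "y = b" | "x = c" "y = d"
      using x(1) m_xy misses_unique[OF W q, of y] misses_unique[OF W ab(1), of y] misses_unique[OF W cd(1), of y] by auto
    then show ?thesis
    proof cases
      case 1
      have "{x', x''} = {a, c}" "{y', y''} = {b, d}"
        using x(2) y(2) dist unfolding \<open>x = _\<close> \<open>y = _\<close> by auto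
      then have xy': "x' = a \<and> x'' = c \<or> x' = c \<and> x'' = a" "y' = b \<and> y'' = d \<or> y' = d \<and> y'' = b"
        unfolding doubleton_eq_iff by blast+
      then have "cross {a, b} {c, d} \<or> cross {a, d} {b, c}"
        using cr cross_sym[OF cr] by (auto simp: insert_commute)
      \<comment> \<open>The split that separates only \<open>v\<close> and \<open>q\<close> gives a
        crossing on the same four vertices without the edge \<open>{a, b}\<close>, and four vertices
        carry only one crossing.\<close>
      moreover have "\<not> cross {a, b} {c, d}"
      proof
        assume c: "cross {a, b} {c, d}"
        have "cross {a, c} {b, d} \<or> cross {a, d} {b, c}"
          by (rule missing_pairs_crossing[OF W _ _ ab(1) cd(1) q]) (use W_eq dist in auto)
        then show False
          using unique[OF c, of "{a, c}" "{b, d}" v] unique[OF c, of "{a, d}" "{b, c}" v] W_eq dist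
          by (auto simp: doubleton_eq_iff)
      qed
      ultimately show ?thesis by blast
    next
      case 2
      have "{x', x''} = {v, c}" "{y', y''} = {q, d}"
        using x(2) y(2) dist unfolding \<open>x = _\<close> \<open>y = _\<close> by auto
      then have xy': "x' = v \<and> x'' = c \<or> x' = c \<and> x'' = v" "y' = q \<and> y'' = d \<or> y' = d \<and> y'' = q"
        unfolding doubleton_eq_iff by blast+
      \<comment> \<open>The known crossing on these four vertices has its edge \<open>{v, c}\<close>
        within one side of the split, while the edges of the new one run between the sides.\<close>
      have "{{v, c}, {q, d}} = {{x', y'}, {x'', y''}}"
        using xy' by (intro unique[OF cd(3) cr, of a]) (use W_eq dist in auto)
      then show ?thesis
        using xy' dist by (auto simp: doubleton_eq_iff)
    next
      case 3
      have "{x', x''} = {v, a}" "{y', y''} = {q, b}"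
        using x(2) y(2) dist unfolding \<open>x = _\<close> \<open>y = _\<close> by auto
      then have xy': "x' = v \<and> x'' = a \<or> x' = a \<and> x'' = v" "y' = q \<and> y'' = b \<or> y' = b \<and> y'' = q"
        unfolding doubleton_eq_iff by blast+
      have "{{v, a}, {q, b}} = {{x', y'}, {x'', y''}}"
        using xy' by (intro unique[OF ab(3) cr, of c]) (use W_eq dist in auto)
      then show ?thesis
        using xy' dist by (auto simp: doubleton_eq_iff)
    qed
  qed
  with W_eq dist ab(3) cd(3) show thesis using that by blast
qed

text \<open>The crossings that avoid \<open>v\<close> and \<open>u\<close> lie in \<open>S\<close>
  and agree, so \<open>q = q'\<close>. Each edge at \<open>q\<close> is crossed only once, so those
  crossed from \<open>v\<close> and those crossed from \<open>u\<close> differ. This forces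
  \<open>{u, b}\<close> to cross \<open>{q, a}\<close>, which shares \<open>q\<close>,
  \<open>a\<close>, \<open>b\<close> with the crossing of \<open>{v, a}\<close> and
  \<open>{q, b}\<close>.\<close>

lemma two_K6_sharing_K5:
  assumes cl: "clique (insert v S)" "clique (insert u S)" and S: "card S = 5" "v \<notin> S" "u \<notin> S" and uv: "u \<noteq> v"
  shows False
proof -
  have fin: "finite S" using S by (simp add: card_ge_0_finite)
  have card6: "card (insert v S) = 6" "card (insert u S) = 6" using S fin by auto
  obtain q a b c d where W: "insert v S = {v, q, a, b, c, d}" "distinct [v, q, a, b, c, d]"
    and x: "cross {v, a} {q, b}" "cross {v, c} {q, d}" "cross {a, d} {b, c}"
    by (rule K6_crossings[OF cl(1) card6(1) insertI1])
  obtain q' a' b' c' d' where W': "insert u S = {u, q', a', b', c', d'}" "distinct [u, q', a', b', c', d']"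
    and x': "cross {u, a'} {q', b'}" "cross {u, c'} {q', d'}" "cross {a', d'} {b', c'}"
    by (rule K6_crossings[OF cl(2) card6(2) insertI1])
  have "S = insert v S - {v}" using S(2) by simp
  also have "\<dots> = {q, a, b, c, d}" unfolding W(1) using W(2) by auto
  finally have S1: "S = {q, a, b, c, d}" .
  have "S = insert u S - {u}" using S(3) by simp
  also have "\<dots> = {q', a', b', c', d'}" unfolding W'(1) using W'(2) by auto
  finally have S2: "S = {q', a', b', c', d'}" .
  have adj: "{x, y} \<in> E" if "x \<in> insert v S" "y \<in> insert v S" "x \<noteq> y" for x y
    using cl(1) that unfolding clique_def by blast
  have inV: "insert v S \<subseteq> V" using cl(1) unfolding clique_def by blast
  have un: "{a, d} \<union> {b, c} = S - {q}" using W(2) unfolding S1 by auto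
  have un': "{a', d'} \<union> {b', c'} = S - {q'}" using W'(2) unfolding S2 by auto
  have same: "{{a, d}, {b, c}} = {{a', d'}, {b', c'}}"
  proof (rule ccontr)
    assume ne: "{{a, d}, {b, c}} \<noteq> {{a', d'}, {b', c'}}"
    \<comment> \<open>Each crossing omits just one vertex of \<open>S\<close>, so the two have at
      least three common vertices, all adjacent to \<open>v\<close>.\<close>
    have "card S - card {q, q'} \<le> card (S - {q, q'})" by (rule diff_card_le_card_Diff) simp
    moreover have "card {q, q'} \<le> 2" by (simp add: card_insert_if)
    ultimately have "3 \<le> card (S - {q, q'})" using S(1) by linarith
    then obtain T where T: "T \<subseteq> S - {q, q'}" "card T = 3" by (rule obtain_subset_with_card_n)
    show False
    proof (rule crossings_sharing_three[OF x(3) x'(3) distinct_crossings[OF x(3) x'(3) ne], of T v])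
      show "T \<subseteq> {a, d} \<union> {b, c}" "T \<subseteq> {a', d'} \<union> {b', c'}" unfolding un un' using T(1) by auto
      show "v \<in> V" "v \<notin> {a, d} \<union> {b, c}" "v \<notin> {a', d'} \<union> {b', c'}" unfolding un un' using inV S(2) by auto
      show "{y, v} \<in> E" if "y \<in> T" for y using that T(1) S(2) by (intro adj) auto
    qed (rule T(2))
  qed
  have q: "q' = q"
  proof -
    have "{a, d} \<union> {b, c} = {a', d'} \<union> {b', c'}" using arg_cong[OF same, of Union] by simp
    then have "S - {q} = S - {q'}" unfolding un un' .
    moreover have "q \<in> S" unfolding S1 by simp
    ultimately show ?thesis by blast
  qed
  have no_common_edge: "y' \<noteq> y" if "cross {v, x} {q, y}" "cross {u, x'} {q, y'}" "x \<in> S" for x x' y y'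
  proof
    assume "y' = y"
    then have "{v, x} = {u, x'}"
      using cross_unique[OF cross_sym[OF that(1)]] cross_sym[OF that(2)] by simp
    then have "u \<in> {v, x}" by simp
    then show False using uv S(3) that(3) by auto
  qed
  note x'_q = x'(1,2)[unfolded q]
  have "a \<in> S" "c \<in> S" unfolding S1 by simp_all
  then have no_pb: "b' \<noteq> b" "b' \<noteq> d" "d' \<noteq> b" "d' \<noteq> d"
    using no_common_edge[OF x(1) x'_q(1)] no_common_edge[OF x(2) x'_q(1)]
      no_common_edge[OF x(1) x'_q(2)] no_common_edge[OF x(2) x'_q(2)] by simp_all
  have no_ub: "\<not> cross {u, b} {q, a}"
  proof
    assume c: "cross {u, b} {q, a}"
    show False
    \<comment> \<open>Here \<open>c\<close> is first the assumed crossing and then the vertex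
      adjacent to \<open>q\<close>, \<open>a\<close> and \<open>b\<close>.\<close>
    proof (rule crossings_sharing_three[OF x(1) c, of "{q, a, b}" c])
      show "{v, a} \<noteq> {u, b}" "{v, a} \<noteq> {q, a}"
        using W(2) uv by (auto simp: doubleton_eq_iff)
      show "card {q, a, b} = 3" using W(2) by auto
      show "c \<in> V" using inV S1 by auto
      show "c \<notin> {v, a} \<union> {q, b}" using W(2) by auto
      show "c \<notin> {u, b} \<union> {q, a}" using W(2) S(3) \<open>c \<in> S\<close> by auto
      show "{y, c} \<in> E" if "y \<in> {q, a, b}" for y
        using that W(2) S1 by (intro adj) auto
    qed auto
  qed
  have "{a, d} = {a', d'} \<and> {b, c} = {b', c'} \<or> {a, d} = {b', c'} \<and> {b, c} = {a', d'}"
    using same unfolding doubleton_eq_iff[of "{a, d}"] .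
  \<comment> \<open>As \<open>b'\<close> and \<open>d'\<close> avoid \<open>b\<close> and
    \<open>d\<close>, the first case forces \<open>d' = a\<close> and \<open>c' = b\<close>, the
    second \<open>b' = a\<close> and \<open>a' = b\<close>.\<close>
  then have "a' = b \<and> b' = a \<or> c' = b \<and> d' = a"
    unfolding doubleton_eq_iff using no_pb by blast
  then show False using x'_q no_ub by auto
qed

end

subsection \<open>A 1-visibility representation\<close>

lemma vertical_segment:
  assumes "y1 \<le> y2"
  shows "closed_segment (Complex x y1) (Complex x y2) = {z. Re z = x \<and> y1 \<le> Im z \<and> Im z \<le> y2}"
  using assms by (auto simp: closed_segment_same_Re closed_segment_eq_real_ivl)

lemma horizontal_segment:
  assumes "x1 \<le> x2"
  shows "closed_segment (Complex x1 y) (Complex x2 y) = {z. Im z = y \<and> x1 \<le> Re z \<and> Re z \<le> x2}"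
  using assms by (auto simp: closed_segment_same_Im closed_segment_eq_real_ivl)

text \<open>Bars have different heights and edges have different columns, so each kind of segment is
  disjoint within itself. The relation \<open>C\<close> only has to contain the crossings that
  occur, and its uniqueness properties give both bounds.\<close>

lemma one_visible_bars:
  fixes lo hi :: "nat \<Rightarrow> int" and col :: "nat \<Rightarrow> nat \<Rightarrow> int" and adj :: "nat \<Rightarrow> nat \<Rightarrow> bool"
  assumes E: "E = {{i, j} |i j. i < j \<and> j < n \<and> adj i j}"
    and bar: "\<And>v. v < n \<Longrightarrow> lo v \<le> hi v"
    and ends: "\<And>i j. i < j \<Longrightarrow> j < n \<Longrightarrow> adj i j \<Longrightarrow>
      lo i \<le> col i j \<and> col i j \<le> hi i \<and> lo j \<le> col i j \<and> col i j \<le> hi j"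
    and inj: "\<And>i j i' j'. i < j \<Longrightarrow> j < n \<Longrightarrow> adj i j \<Longrightarrow> i' < j' \<Longrightarrow> j' < n \<Longrightarrow> adj i' j' \<Longrightarrow>
      col i j = col i' j' \<Longrightarrow> i = i' \<and> j = j'"
    and cross: "\<And>i w j. i < w \<Longrightarrow> w < j \<Longrightarrow> j < n \<Longrightarrow> adj i j \<Longrightarrow> lo w \<le> col i j \<Longrightarrow> col i j \<le> hi w \<Longrightarrow> C i w j"
    and edge_once: "\<And>i w w' j. C i w j \<Longrightarrow> C i w' j \<Longrightarrow> w = w'"
    and vertex_once: "\<And>i w j i' j'. C i w j \<Longrightarrow> C i' w j' \<Longrightarrow> i = i' \<and> j = j'"
  shows "one_visible {..<n} E"
proof -
  define a where "a v = Complex (of_int (lo v)) (of_nat v)" for v :: nat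
  define b where "b v = Complex (of_int (hi v)) (of_nat v)" for v :: nat
  define c where "c e = Complex (of_int (col (Min e) (Max e))) (of_nat (Min e))" for e :: "nat set"
  define d where "d e = Complex (of_int (col (Min e) (Max e))) (of_nat (Max e))" for e :: "nat set"
  have edgeE: "\<exists>i j. e = {i, j} \<and> i < j \<and> j < n \<and> adj i j \<and> Min e = i \<and> Max e = j" if "e \<in> E" for e
    using that unfolding E by force
  have bars: "closed_segment (a v) (b v) = {z. Im z = of_nat v \<and> of_int (lo v) \<le> Re z \<and> Re z \<le> of_int (hi v)}"
    if "v < n" for v
    unfolding a_def b_def using bar[OF that] by (intro horizontal_segment) simp
  have segs: "closed_segment (c e) (d e) = {z. Re z = of_int (col i j) \<and> of_nat i \<le> Im z \<and> Im z \<le> of_nat j}"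
    if "Min e = i" "Max e = j" "i < j" for e i j
    unfolding c_def d_def using that by (simp add: vertical_segment)
  have crosses: "i < w \<and> w < j \<and> C i w j"
    if e: "e = {i, j}" "i < j" "j < n" "adj i j" "Min e = i" "Max e = j" and w_lt: "w < n"
      and cr: "crosses_vertex a b c d e w" for e i j w
  proof -
    have w: "w \<noteq> i" "w \<noteq> j" using cr e(1) unfolding crosses_vertex_def by auto
    obtain z where z: "Re z = of_int (col i j)" "of_nat i \<le> Im z" "Im z \<le> of_nat j" "Im z = of_nat w"
       "of_int (lo w) \<le> Re z" "Re z \<le> of_int (hi w)"
      using cr unfolding crosses_vertex_def bars[OF w_lt] segs[OF e(5,6,2)] by blast
    then have "i < w" "w < j" "lo w \<le> col i j" "col i j \<le> hi w" using w by auto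
    then show ?thesis using cross e by auto
  qed
  have "one_visibility_representation {..<n} E a b c d"
    unfolding one_visibility_representation_def
  proof (intro conjI ballI impI)
    fix v assume "v \<in> {..<n}"
    show "grid_point (a v)" "grid_point (b v)" "Im (a v) = Im (b v)"
      unfolding grid_point_def a_def b_def by auto
  next
    fix e assume "e \<in> E"
    show "grid_point (c e)" "grid_point (d e)" "Re (c e) = Re (d e)"
      unfolding grid_point_def c_def d_def by auto
    obtain i j where ij: "e = {i, j}" "i < j" "j < n" "adj i j" "Min e = i" "Max e = j" using edgeE[OF \<open>e \<in> E\<close>] by blast
    have "c e \<in> closed_segment (a i) (b i)" "d e \<in> closed_segment (a j) (b j)"
      unfolding c_def d_def ij(5,6) using bars[of i] bars[of j] ends[OF ij(2-4)] ij(2,3) by auto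
    then show "\<exists>u v. e = {u, v} \<and> c e \<in> closed_segment (a u) (b u) \<and> d e \<in> closed_segment (a v) (b v)"
      using ij(1) by blast
  next
    fix v w :: nat assume "v \<in> {..<n}" "w \<in> {..<n}" "v \<noteq> w"
    then show "closed_segment (a v) (b v) \<inter> closed_segment (a w) (b w) = {}"
      using bars[of v] bars[of w] by auto
  next
    fix e f assume ef: "e \<in> E" "f \<in> E" "e \<noteq> f"
    obtain i j where ij: "e = {i, j}" "i < j" "j < n" "adj i j" "Min e = i" "Max e = j" using edgeE[OF ef(1)] by blast
    obtain i' j' where ij': "f = {i', j'}" "i' < j'" "j' < n" "adj i' j'" "Min f = i'" "Max f = j'" using edgeE[OF ef(2)] by blast
    have "col i j \<noteq> col i' j'" using inj[OF ij(2-4) ij'(2-4)] ef(3) ij(1) ij'(1) by auto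
    then have "closed_segment (c e) (d e) \<inter> closed_segment (c f) (d f) = {}"
      unfolding segs[OF ij(5,6,2)] segs[OF ij'(5,6,2)] by auto
    then show "open_segment (c e) (d e) \<inter> open_segment (c f) (d f) = {}"
      unfolding open_segment_def by blast
  next
    fix w assume w: "w \<in> {..<n}"
    have "e = f" if e: "e \<in> E" "crosses_vertex a b c d e w" and f: "f \<in> E" "crosses_vertex a b c d f w" for e f
    proof -
      obtain i j where ij: "e = {i, j}" "i < j" "j < n" "adj i j" "Min e = i" "Max e = j" using edgeE[OF e(1)] by blast
      obtain i' j' where ij': "f = {i', j'}" "i' < j'" "j' < n" "adj i' j'" "Min f = i'" "Max f = j'" using edgeE[OF f(1)] by blast
      have "C i w j" "C i' w j'" using crosses[OF ij _ e(2)] crosses[OF ij' _ f(2)] w by auto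
      then show ?thesis using vertex_once[of i w j i' j'] ij(1) ij'(1) by simp
    qed
    \<comment> \<open>An infinite set has \<open>card\<close> 0, which settles that case.\<close>
    then show "card {e \<in> E. crosses_vertex a b c d e w} \<le> 1"
      by (cases "finite {e \<in> E. crosses_vertex a b c d e w}") (auto simp: card_le_Suc0_iff_eq)
  next
    fix e assume "e \<in> E"
    then obtain i j where ij: "e = {i, j}" "i < j" "j < n" "adj i j" "Min e = i" "Max e = j" using edgeE by blast
    have "w = w'" if "w < n" "crosses_vertex a b c d e w" "w' < n" "crosses_vertex a b c d e w'" for w w'
      using edge_once[of i w j w'] crosses[OF ij that(1,2)] crosses[OF ij that(3,4)] by blast
    then show "card {w \<in> {..<n}. crosses_vertex a b c d e w} \<le> 1"
      by (auto simp: card_le_Suc0_iff_eq)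
  qed
  then show ?thesis unfolding one_visible_def by blast
qed

text \<open>Only pairs with \<open>i < j\<close> count. For \<open>j = 7\<close> the vertex
  \<open>j - 2\<close> would be 5 again, so 4 takes its place and there are still four lower
  neighbours.\<close>

definition nbr :: "nat \<Rightarrow> nat \<Rightarrow> bool" where
  "nbr i j \<longleftrightarrow> (if j < 7 then \<not> (i = 1 \<and> j = 5) else i \<in> {0, 5, j - 1, if j = 7 then 4 else j - 2})"

definition edges :: "nat \<Rightarrow> nat set set" where
  "edges n = {{i, j} |i j. i < j \<and> j < n \<and> nbr i j}"

text \<open>
  The bar of \<open>v\<close> has height \<open>v\<close>. Those of \<open>0\<close> and \<open>5\<close> extend beyond all others to the right and to the left.
\<close>

definition bar_lo :: "nat \<Rightarrow> nat \<Rightarrow> int" where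
  "bar_lo n v = (if v < 7 then [0, 15, 10, 5, 15, 20 - 3 * int n, 5] ! v else 20 - 3 * int v)"

definition bar_hi :: "nat \<Rightarrow> nat \<Rightarrow> int" where
  "bar_hi n v = (if v < 7 then [39 + int n, 40, 25, 20, 35, 20, 45] ! v else 39 + int v)"

text \<open>For \<open>j < 7\<close> the table has the row \<open>j\<close> and the column \<open>i\<close>; the entry for the missing edge \<open>{1, 5}\<close> is arbitrary.\<close>

definition edge_col :: "nat \<Rightarrow> nat \<Rightarrow> int" where
  "edge_col i j =
     (if j < 7 then
        [[], [31], [11, 21], [6, 16, 14], [27, 26, 22, 17], [2, 0, 12, 13, 18], [41, 36, 23, 7, 28, 8]] ! j ! i
      else if i = 5 then 20 - 3 * int j
      else if i = 0 then 39 + int j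
      else if i + 1 = j then (if j = 7 then 42 else 24 - 3 * int j)
      else (if j = 7 then 32 else if j = 8 then 43 else 28 - 3 * int j))"

text \<open>Entry \<open>w\<close> of the list is the edge that passes through the bar of
  \<open>w\<close>. Entry 0 is a dummy excluded by \<open>1 \<le> w\<close>, as nothing lies below
  the bar of 0. Triples with \<open>j\<close> beyond the graph may occur, since a superset of the
  crossings is enough.\<close>

definition bar_cross :: "nat \<Rightarrow> nat \<Rightarrow> nat \<Rightarrow> bool" where
  "bar_cross i w j \<longleftrightarrow>
     1 \<le> w \<and> (i, j) = (if w < 7 then [(0, 0), (0, 4), (1, 3), (2, 5), (2, 6), (3, 6), (4, 7)] ! w else (w - 1, w + 1))"

section \<open>Verification of the layout, edge by edge\<close>

lemma nbr_small:
  assumes "i < j" "j < 7" "nbr i j"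
  shows "(i, j) \<in> {(0, 1), (0, 2), (1, 2), (0, 3), (1, 3), (2, 3), (0, 4), (1, 4), (2, 4), (3, 4), (0, 5), (2, 5), (3, 5), (4, 5), (0, 6), (1, 6), (2, 6), (3, 6), (4, 6), (5, 6)}"
proof -
  have "j \<in> {0, 1, 2, 3, 4, 5, 6}" "i \<in> {0, 1, 2, 3, 4, 5, 6}" using assms by auto
  moreover have "\<not> (i = 1 \<and> j = 5)" using assms unfolding nbr_def by simp
  ultimately show ?thesis using assms(1) by (elim insertE emptyE) simp_all
qed

text \<open>From 7 on the left ends of the bars follow \<open>20 - 3 * int v\<close>, but those of 4
  and 6 do not. The edges from 7 and 8 down to 4 and 6 therefore have the special columns 32, 42 and
  43.\<close>

lemma nbr_large:
  assumes "i < j" "7 \<le> j" "nbr i j"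
  obtains "i = 5" "edge_col i j = 20 - 3 * int j" | "i = 0" "edge_col i j = 39 + int j"
    | "i = 6" "j = 7" "edge_col i j = 42" | "8 \<le> j" "i = j - 1" "edge_col i j = 24 - 3 * int j"
    | "i = 4" "j = 7" "edge_col i j = 32" | "i = 6" "j = 8" "edge_col i j = 43"
    | "9 \<le> j" "i = j - 2" "edge_col i j = 28 - 3 * int j"
proof -
  consider "i = 5" | "i = 0" | "i = 6" "j = 7" | "8 \<le> j" "i = j - 1"
    | "i = 4" "j = 7" | "i = 6" "j = 8" | "9 \<le> j" "i = j - 2"
  proof -
    have "j = 7 \<or> j = 8 \<or> 9 \<le> j" using assms(2) by auto
    then show thesis using that assms(1,3) unfolding nbr_def by (auto split: if_splits)
  qed
  then show thesis
  proof cases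
    case 7
    then have "i \<noteq> 5" "i \<noteq> 0" "i + 1 \<noteq> j" "\<not> j < 7" "j \<noteq> 7" "j \<noteq> 8" by auto
    then show thesis using that(7)[OF 7] by (simp add: edge_col_def)
  qed (use that assms(2) in \<open>auto simp: edge_col_def\<close>)
qed

lemma bar_ends:
  assumes "i < j" "j < n" "nbr i j"
  shows "bar_lo n i \<le> edge_col i j \<and> edge_col i j \<le> bar_hi n i \<and>
    bar_lo n j \<le> edge_col i j \<and> edge_col i j \<le> bar_hi n j"
proof (cases "j < 7")
  case True
  show ?thesis
    using nbr_small[OF assms(1) True assms(3)] assms(2)
    by (elim insertE emptyE) (simp_all add: bar_lo_def bar_hi_def edge_col_def)
next
  case False
  then have "7 \<le> j" by simp
  then show ?thesis
    by (rule nbr_large[OF assms(1) _ assms(3)])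
       (use assms(2) False in \<open>auto simp: bar_lo_def bar_hi_def\<close>)
qed

text \<open>For \<open>j\<close> from 7 on, the columns to 5 and 0 are the two ends of the bar of
  \<open>j\<close> and pass beside all bars in between. The column \<open>24 - 3 * int j\<close>
  leads directly to the bar of \<open>j - 1\<close>, and \<open>28 - 3 * int j\<close> goes through
  that bar to the one of \<open>j - 2\<close>.\<close>

lemma bar_crossings:
  assumes "i < w" "w < j" "j < n" "nbr i j" "bar_lo n w \<le> edge_col i j" "edge_col i j \<le> bar_hi n w"
  shows "bar_cross i w j"
proof (cases "j < 7")
  case True
  have "i < j" "w \<in> {0, 1, 2, 3, 4, 5, 6}" using assms(1,2) True by auto
  then show ?thesis
    using nbr_small[OF _ True assms(4)] assms(1,2,5,6)
    by (elim insertE emptyE) (auto simp: bar_lo_def bar_hi_def edge_col_def bar_cross_def)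
next
  case False
  then have j: "i < j" "7 \<le> j" using assms by simp_all
  show ?thesis
  proof (cases "w < 7")
    case True
    then have w: "w \<in> {0, 1, 2, 3, 4, 5, 6}" by auto
    show ?thesis
      by (rule nbr_large[OF j assms(4)]; insert w assms(1,2,5,6); elim insertE emptyE;
          simp add: bar_lo_def bar_hi_def bar_cross_def)
  next
    case False
    show ?thesis
      by (rule nbr_large[OF j assms(4)])
         (use assms(1,2,5,6) False in \<open>auto simp: bar_lo_def bar_hi_def bar_cross_def\<close>)
  qed
qed

text \<open>Columns of edges below 7 range from 2 to 43 without 32, 42 and 43. The later columns are
  these three, at least 46, or at most 1; the last kind is separated by residues, since 20, 24 and
  28 differ modulo 3.\<close>

lemma edge_col_inj:
  assumes "i < j" "nbr i j" "i' < j'" "nbr i' j'" "edge_col i j = edge_col i' j'"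
  shows "i = i' \<and> j = j'"
proof -
  have small: "edge_col i j \<in> {2..43} - {32, 42, 43}" if "i < j" "j < 7" "nbr i j" for i j
    using nbr_small[OF that] by (elim insertE emptyE) (simp_all add: edge_col_def)
  have large: "edge_col i j \<notin> {2..43} - {32, 42, 43}" if "i < j" "7 \<le> j" "nbr i j" for i j
    by (rule nbr_large[OF that]) (use that(2) in auto)
  consider "j < 7" "j' < 7" | "7 \<le> j" "7 \<le> j'"
    using small[OF assms(1) _ assms(2)] small[OF assms(3) _ assms(4)]
      large[OF assms(1) _ assms(2)] large[OF assms(3) _ assms(4)] assms(5) by fastforce
  then show ?thesis
  proof cases
    case 1
    show ?thesis
      using nbr_small[OF assms(1) 1(1) assms(2)] nbr_small[OF assms(3) 1(2) assms(4)] assms(5)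
      by (elim insertE emptyE) (simp_all add: edge_col_def)
  next
    case 2
    show ?thesis
      by (rule nbr_large[OF assms(1) 2(1) assms(2)]; rule nbr_large[OF assms(3) 2(2) assms(4)];
          use assms(5) 2 in presburger)
  qed
qed

text \<open>Reading \<open>w\<close> off from \<open>i\<close> and \<open>j\<close> makes uniqueness
  immediate, without comparing all pairs of entries.\<close>

lemma bar_cross_vertex_eq:
  assumes "bar_cross i w j"
  shows "w = (if 8 \<le> j then j - 1 else if j = 7 then 6 else if i = 2 then j - 2 else if i = 3 then 5 else i + 1)"
proof (cases "w < 7")
  case True
  then have "w \<in> {0, 1, 2, 3, 4, 5, 6}" by auto
  then show ?thesis using assms by (elim insertE emptyE) (simp_all add: bar_cross_def)
next
  case False
  then show ?thesis using assms by (simp add: bar_cross_def)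
qed

lemma bar_cross_unique_vertex:
  assumes "bar_cross i w j" "bar_cross i w' j" shows "w = w'"
  by (simp only: bar_cross_vertex_eq[OF assms(1)] bar_cross_vertex_eq[OF assms(2)])

lemma bar_cross_unique_edge:
  assumes "bar_cross i w j" "bar_cross i' w j'" shows "i = i' \<and> j = j'"
proof -
  have "(i, j) = (i', j')" using assms unfolding bar_cross_def by (elim conjE) (rule trans[OF _ sym])
  then show ?thesis by simp
qed

lemma one_visible_edges: "one_visible {..<n} (edges n)"
proof (rule one_visible_bars[where lo = "bar_lo n" and hi = "bar_hi n" and col = edge_col and adj = nbr and C = bar_cross])
  show "bar_lo n v \<le> bar_hi n v" if "v < n" for v
  proof (cases "v < 7")
    case True
    then have "v \<in> {0, 1, 2, 3, 4, 5, 6}" by auto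
    then show ?thesis by (elim insertE emptyE) (simp_all add: bar_lo_def bar_hi_def)
  qed (simp add: bar_lo_def bar_hi_def)
  show "w = w'" if "bar_cross i w j" "bar_cross i w' j" for i w w' j
    by (rule bar_cross_unique_vertex[OF that])
  show "i = i' \<and> j = j'" if "bar_cross i w j" "bar_cross i' w j'" for i w j i' j'
    by (rule bar_cross_unique_edge[OF that])
  show "i = i' \<and> j = j'"
    if "i < j" "j < n" "nbr i j" "i' < j'" "j' < n" "nbr i' j'" "edge_col i j = edge_col i' j'" for i j i' j'
    by (rule edge_col_inj[OF that(1,3,4,6,7)])
  show "bar_lo n i \<le> edge_col i j \<and> edge_col i j \<le> bar_hi n i \<and>
      bar_lo n j \<le> edge_col i j \<and> edge_col i j \<le> bar_hi n j"
    if "i < j" "j < n" "nbr i j" for i j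
    by (rule bar_ends[OF that])
  show "bar_cross i w j"
    if "i < w" "w < j" "j < n" "nbr i j" "bar_lo n w \<le> edge_col i j" "edge_col i j \<le> bar_hi n w" for i w j
    by (rule bar_crossings[OF that])
qed (rule edges_def)

section \<open>The number of edges, and the failure of 1-planarity\<close>

lemma card_edges:
  assumes "7 \<le> n"
  shows "card (edges n) = 4 * n - 8"
proof -
  define P where "P = Sigma {..<n} (\<lambda>j. {i. i < j \<and> nbr i j})"
  have "edges n = (\<lambda>(j, i). {i, j}) ` P"
    unfolding edges_def P_def by auto
  moreover have "inj_on (\<lambda>(j, i). {i, j}) P"
    unfolding P_def by (auto simp: inj_on_def doubleton_eq_iff)
  ultimately have "card (edges n) = card P" by (simp add: card_image)
  also have "\<dots> = (\<Sum>j<n. card {i. i < j \<and> nbr i j})"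
    unfolding P_def by (rule card_SigmaI) auto
  also have "\<dots> = 4 * n - 8"
    using assms
  proof (induction n rule: nat_induct_at_least)
    case base
    have "{i. i < j \<and> nbr i j} = (if j = 5 then {..<5} - {1} else {..<j})" if "j < 7" for j
      using that by (auto simp: nbr_def)
    then have "(\<Sum>j<7. card {i. i < j \<and> nbr i j}) = (\<Sum>j<7. if j = 5 then 4 else j)"
      by (intro sum.cong) auto
    \<comment> \<open>This is 21 - 1 for the missing edge, and equals 4 * 7 - 8.\<close>
    also have "\<dots> = (20::nat)" by (simp add: eval_nat_numeral)
    finally show ?case by simp
  next
    case (Suc n)
    \<comment> \<open>From 8 on, \<open>n - 2\<close> is at least 6, so the four lower neighbours
      are distinct; for 7 they are 0, 5, 6 and 4.\<close>
    have "{i. i < n \<and> nbr i n} = {0, 5, n - 1, if n = 7 then 4 else n - 2}"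
      using Suc by (auto simp: nbr_def)
    moreover have "card {0, 5, n - 1, if n = 7 then 4 else n - 2} = 4"
      using Suc(1) by (cases "n = 7") (auto simp: card_insert_if)
    ultimately show ?case using Suc by simp
  qed
  finally show ?thesis .
qed

lemma simple_graph_edges: "simple_graph {..<n} (edges n)"
  unfolding simple_graph_def edges_def by auto

text \<open>Removing 5 or 1 from the vertices 0 to 6 leaves two copies of K6 with five common
  vertices. \<open>clique\<close> concerns vertex sets of the given drawing, so the later vertices
  can stay in it.\<close>

lemma not_one_planar_edges:
  assumes "7 \<le> n"
  shows "\<not> one_planar {..<n} (edges n)"
proof
  assume "one_planar {..<n} (edges n)"
  then obtain p g where "one_planar_drawing {..<n} (edges n) p g"
    unfolding one_planar_def by blast
  then interpret one_planar_graph "{..<n}" "edges n" p g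
    by unfold_locales (rule simple_graph_edges)
  have edge: "{x, y} \<in> edges n" if "x < 7" "y < 7" "x \<noteq> y" "{x, y} \<noteq> {1, 5}" for x y
  proof -
    have "{min x y, max x y} = {x, y}" by (auto simp: min_def max_def)
    moreover have "min x y < max x y" "max x y < n" "nbr (min x y) (max x y)"
      using that assms by (auto simp: min_def max_def nbr_def insert_commute)
    ultimately show ?thesis unfolding edges_def by blast
  qed
  have clique: "clique W" if "W \<subseteq> {..<7}" "\<not> {1, 5} \<subseteq> W" for W
    unfolding clique_def
  proof (intro conjI ballI impI)
    show "W \<subseteq> {..<n}" using that(1) assms by auto
    show "{x, y} \<in> edges n" if "x \<in> W" "y \<in> W" "x \<noteq> y" for x y
      using that \<open>W \<subseteq> {..<7}\<close> \<open>\<not> {1, 5} \<subseteq> W\<close> by (intro edge) auto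
  qed
  show False
    by (rule two_K6_sharing_K5[of 1 "{0, 2, 3, 4, 6}" 5]) (auto intro!: clique)
qed

theorem theorem2:
  fixes n :: nat
  assumes "n \<ge> 7"
  shows "\<exists>(V :: nat set) (E :: nat set set).
           simple_graph V E \<and> card V = n \<and> card E = 4 * n - 8 \<and>
           one_visible V E \<and> \<not> one_planar V E"
  using simple_graph_edges card_edges[OF assms] one_visible_edges not_one_planar_edges[OF assms]
  by (intro exI[of _ "{..<n}"] exI[of _ "edges n"]) simp

end
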